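(* Let $k\ge 2$, let $p\in\mathbb{C}[x_1,\dots,x_k]\setminus\mathbb{C}$ be a non-constant polynomial, and let $X=\{(\bar x,u,v)\in\mathbb{C}^k\times\mathbb{C}\times\mathbb{C} : uv-p(\bar x)=0\}\subset\mathbb{C}^{k+2}$. Then for every $m\in\mathbb{N}$ the group $\mathrm{Aut}\,X$ of biregular automorphisms of the affine variety $X$ acts $m$-transitively on $X\setminus\mathrm{sing}\,X$.
   Context: $\mathrm{sing}\,X$ is the singular locus of $X$. A group acting on a set $S$ acts $m$-transitively if for any two $m$-tuples $(P_1,\dots,P_m)$ and $(Q_1,\dots,Q_m)$ of pairwise distinct points of $S$ there is an element $g$ of the group with $g(P_i)=Q_i$ for $i=1,\dots,m$. *)

theory Defs
  imports
    "HOL-Analysis.Analysis"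
    "HOL-Algebra.Group_Action"
    "HOL-Library.Poly_Mapping"
    "HOL-Library.Extended_Nat"
begin

section \<open>Complex polynomials in finitely many variables\<close>

text \<open>Monomials are exponent vectors \<open>'n \<Rightarrow>\<^sub>0 nat\<close>; a polynomial maps monomials to coefficients.
  The ring structure of \<open>\<complex>[x\<^sub>i | i :: 'n]\<close> is the convolution product of
  \<^theory>\<open>HOL-Library.Poly_Mapping\<close>.\<close>

type_synonym 'n cpoly = "('n \<Rightarrow>\<^sub>0 nat) \<Rightarrow>\<^sub>0 complex"

definition const_poly :: "complex \<Rightarrow> 'n cpoly"
  where "const_poly c = Poly_Mapping.single 0 c"

definition poly_eval :: "('n::finite) cpoly \<Rightarrow> complex ^ 'n \<Rightarrow> complex"
  where "poly_eval f z =
    (\<Sum>a\<in>Poly_Mapping.keys f. Poly_Mapping.lookup f a * (\<Prod>i\<in>UNIV. (z $ i) ^ Poly_Mapping.lookup a i))"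

section \<open>Zariski topology, tangent spaces and singular points\<close>

definition zariski_closed :: "(complex ^ ('n::finite)) set \<Rightarrow> bool"
  where "zariski_closed Z \<longleftrightarrow> (\<exists>F. Z = {z. \<forall>f\<in>F. poly_eval f z = 0})"

definition zariski_irreducible :: "(complex ^ ('n::finite)) set \<Rightarrow> bool"
  where "zariski_irreducible Z \<longleftrightarrow> Z \<noteq> {} \<and>
    (\<forall>A B. zariski_closed A \<longrightarrow> zariski_closed B \<longrightarrow> Z \<subseteq> A \<union> B \<longrightarrow> Z \<subseteq> A \<or> Z \<subseteq> B)"

definition vanishing_ideal :: "(complex ^ ('n::finite)) set \<Rightarrow> 'n cpoly set"
  where "vanishing_ideal X = {f. \<forall>z\<in>X. poly_eval f z = 0}"

text \<open>The Zariski tangent space (translated to the origin) consists of the vectors killed by the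
  differentials at \<open>P\<close> of all polynomials vanishing on \<open>X\<close>. The derivative below is the value
  \<open>\<Sum>\<^sub>i (\<partial>f/\<partial>x\<^sub>i)(P) w\<^sub>i\<close> of such a differential at \<open>w\<close>.\<close>

definition tangent_space :: "(complex ^ ('n::finite)) set \<Rightarrow> complex ^ 'n \<Rightarrow> (complex ^ 'n) set"
  where "tangent_space X P =
    {w. \<forall>f\<in>vanishing_ideal X. deriv (\<lambda>t. poly_eval f (P + t *s w)) 0 = 0}"

text \<open>The dimension of \<open>X\<close> at \<open>P\<close>, i.e. the Krull dimension of the local ring \<open>\<O>\<^bsub>X,P\<^esub>\<close>: its chains of
  prime ideals correspond to chains of irreducible closed subsets of \<open>X\<close> passing through \<open>P\<close>.\<close>

definition local_dim :: "(complex ^ ('n::finite)) set \<Rightarrow> complex ^ 'n \<Rightarrow> enat"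
  where "local_dim X P = (SUP d \<in> {d. \<exists>Z :: nat \<Rightarrow> (complex ^ 'n) set.
      (\<forall>i\<le>d. zariski_closed (Z i) \<and> zariski_irreducible (Z i) \<and> P \<in> Z i \<and> Z i \<subseteq> X) \<and>
      (\<forall>i<d. Z i \<subset> Z (Suc i))}. enat d)"

text \<open>\<open>P\<close> is a regular point iff the local ring there is regular, i.e. its Krull dimension equals
  the dimension of the (co)tangent space.\<close>

definition sing :: "(complex ^ ('n::finite)) set \<Rightarrow> (complex ^ 'n) set"
  where "sing X = {P \<in> X. enat (vec.dim (tangent_space X P)) \<noteq> local_dim X P}"

section \<open>Biregular automorphisms\<close>

definition regular_map ::
    "(complex ^ ('n::finite)) set \<Rightarrow> (complex ^ ('m::finite)) set \<Rightarrow> (complex ^ 'n \<Rightarrow> complex ^ 'm) \<Rightarrow> bool"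
  where "regular_map X Y g \<longleftrightarrow> g ` X \<subseteq> Y \<and>
    (\<exists>q :: 'm \<Rightarrow> 'n cpoly. \<forall>z\<in>X. \<forall>j. g z $ j = poly_eval (q j) z)"

text \<open>As in \<^const>\<open>BijGroup\<close>, automorphisms are taken to be undefined outside \<open>X\<close>, so that they are
  determined by their values on \<open>X\<close>.\<close>

definition Aut :: "(complex ^ ('n::finite)) set \<Rightarrow> (complex ^ 'n \<Rightarrow> complex ^ 'n) monoid"
  where "Aut X = (BijGroup X)
    \<lparr>carrier := {g \<in> Bij X. regular_map X X g \<and> regular_map X X (inv_into X g)}\<rparr>"

section \<open>Multiple transitivity\<close>

definition acts_m_transitively :: "nat \<Rightarrow> ('g, 'r) monoid_scheme \<Rightarrow> 's set \<Rightarrow> ('g \<Rightarrow> 's \<Rightarrow> 's) \<Rightarrow> bool"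
  where "acts_m_transitively m G S \<phi> \<longleftrightarrow> group_action G S \<phi> \<and>
    (\<forall>P Q :: nat \<Rightarrow> 's.
      P ` {..<m} \<subseteq> S \<longrightarrow> inj_on P {..<m} \<longrightarrow> Q ` {..<m} \<subseteq> S \<longrightarrow> inj_on Q {..<m} \<longrightarrow>
      (\<exists>g\<in>carrier G. \<forall>i<m. \<phi> g (P i) = Q i))"

section \<open>The hypersurface \<open>uv = p(x)\<close>\<close>

text \<open>Index type of the \<open>k + 2\<close> coordinates \<open>(x\<^sub>1, \<dots>, x\<^sub>k, u, v)\<close>, where \<open>k = CARD('k)\<close>.\<close>

datatype 'k coord = Coord_x 'k | Coord_u | Coord_v

instance coord :: (finite) finite
proof
  have "(UNIV :: 'a coord set) \<subseteq> range Coord_x \<union> {Coord_u, Coord_v}"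
    by (auto intro: coord.exhaust)
  then show "finite (UNIV :: 'a coord set)"
    by (rule finite_subset) simp
qed

definition uv_hypersurface :: "('k::finite) cpoly \<Rightarrow> (complex ^ 'k coord) set"
  where "uv_hypersurface p =
    {z. z $ Coord_u * z $ Coord_v - poly_eval p (\<chi> i. z $ Coord_x i) = 0}"

end

(* Idea: the hypersurface uv = p(x) carries the shears x' = x + u h w, v' = v + (p(x') - p(x)) / u,
   with h a function of u and of linear forms killing w, and the same shears with u and v exchanged.
   Inside a slice u = c (c nonzero) two such shears move any point to any other while fixing a given
   finite set; since p is surjective, slices of u and slices of v suffice to join any two points.
   These maps act transitively on the points where the gradient of uv - p does not vanish. Of the
   singular locus it is then only needed that it is invariant and contains all critical points. At
   those the tangent space is everything, while the local dimension is less than k + 2: a chain of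
   n + 1 irreducible closed sets would give n algebraically independent polynomials, and counting
   monomials excludes more than k + 2 of these. *)

theory Submission
  imports Defs "HOL-Computational_Algebra.Fundamental_Theorem_Algebra"
begin

section \<open>Polynomial functions\<close>

text \<open>Singularity is defined through all polynomials vanishing on X, and the ideal of X is
  never determined: the tangent space at a critical point is tested on curves inside X instead.
  Showing that noncritical points are regular would need the exact local dimension. This is avoided
  by proving transitivity on all noncritical points and restricting afterwards to the regular ones,
  which automorphisms permute. The maps are built as automorphisms of the whole affine space
  preserving the function uv - p. There u is not a zero divisor, so identities may be checked after
  multiplication by u. On u = 0 a shear leaves x alone and adds h times the derivative of p along w
  to v; this is how a noncritical point leaves u = v = 0. The condition k \<ge> 2 provides a nonzero
  linear form killing a given w. For k = 1, h would be a function of u alone, and no such shear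
  could move one point of a slice and fix another.\<close>

definition mono_eval :: "complex ^ ('n::finite) \<Rightarrow> ('n \<Rightarrow>\<^sub>0 nat) \<Rightarrow> complex"
  where "mono_eval z a = (\<Prod>i\<in>UNIV. (z $ i) ^ Poly_Mapping.lookup a i)"

lemma mono_eval_zero [simp]: "mono_eval z 0 = 1"
  by (simp add: mono_eval_def)

lemma mono_eval_add: "mono_eval z (a + b) = mono_eval z a * mono_eval z b"
  by (simp add: mono_eval_def lookup_add power_add prod.distrib)

lemma mono_eval_mult: "mono_eval (\<chi> i. y $ i * z $ i) a = mono_eval y a * mono_eval z a"
  by (simp add: mono_eval_def power_mult_distrib prod.distrib)

lemma poly_eval_eq_sum:
  assumes "finite A" "Poly_Mapping.keys f \<subseteq> A"
  shows "poly_eval f z = (\<Sum>a\<in>A. Poly_Mapping.lookup f a * mono_eval z a)"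
  unfolding poly_eval_def mono_eval_def
  using assms by (intro sum.mono_neutral_left) (auto simp: in_keys_iff)

lemma poly_eval_single [simp]: "poly_eval (Poly_Mapping.single a c) z = c * mono_eval z a"
  by (subst poly_eval_eq_sum[of "{a}"]) auto

lemma poly_eval_0 [simp]: "poly_eval 0 z = 0"
  by (simp add: poly_eval_def)

lemma poly_eval_1 [simp]: "poly_eval 1 z = 1"
  using poly_eval_single[of 0 1 z] by simp

lemma poly_eval_const_poly [simp]: "poly_eval (const_poly c) z = c"
  by (simp add: const_poly_def)

lemma poly_eval_add [simp]: "poly_eval (f + g) z = poly_eval f z + poly_eval g z"
proof -
  let ?A = "Poly_Mapping.keys f \<union> Poly_Mapping.keys g"
  have "poly_eval (f + g) z = (\<Sum>a\<in>?A. Poly_Mapping.lookup (f + g) a * mono_eval z a)"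
    by (rule poly_eval_eq_sum) (auto simp: keys_add)
  also have "\<dots> = poly_eval f z + poly_eval g z"
    by (simp add: poly_eval_eq_sum[of ?A f] poly_eval_eq_sum[of ?A g] lookup_add
        distrib_right sum.distrib)
  finally show ?thesis .
qed

lemma poly_eval_sum: "poly_eval (\<Sum>a\<in>A. f a) z = (\<Sum>a\<in>A. poly_eval (f a) z)"
  by (induction A rule: infinite_finite_induct) auto

lemma poly_mapping_sum_single:
  "f = (\<Sum>a\<in>Poly_Mapping.keys f. Poly_Mapping.single a (Poly_Mapping.lookup f a))"
  by (rule poly_mapping_eqI)
    (simp add: lookup_sum lookup_single when_def sum.delta' in_keys_iff)

lemma poly_eval_mult [simp]: "poly_eval (f * g) z = poly_eval f z * poly_eval g z"
proof -
  have "poly_eval (f * g) z = poly_eval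
    ((\<Sum>a\<in>Poly_Mapping.keys f. Poly_Mapping.single a (Poly_Mapping.lookup f a)) *
     (\<Sum>b\<in>Poly_Mapping.keys g. Poly_Mapping.single b (Poly_Mapping.lookup g b))) z"
    using poly_mapping_sum_single[of f] poly_mapping_sum_single[of g] by simp
  also have "\<dots> = poly_eval f z * poly_eval g z"
    by (simp add: sum_product poly_eval_sum mult_single mono_eval_add poly_eval_eq_sum[OF _ order_refl]
        mult_ac)
  finally show ?thesis .
qed

lemma poly_eval_power [simp]: "poly_eval (f ^ n) z = poly_eval f z ^ n"
  by (induction n) auto

lemma poly_eval_uminus [simp]: "poly_eval (- f) z = - poly_eval f z"
  using poly_eval_add[of f "- f" z] by (simp add: eq_neg_iff_add_eq_0 add.commute)

lemma poly_eval_diff [simp]: "poly_eval (f - g) z = poly_eval f z - poly_eval g z"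
  using poly_eval_add[of f "- g" z] by simp

lemma mono_eval_separates:
  fixes a b :: "('n::finite) \<Rightarrow>\<^sub>0 nat"
  assumes "a \<noteq> b"
  obtains z where "mono_eval z a \<noteq> mono_eval z b"
proof -
  obtain i where i: "Poly_Mapping.lookup a i \<noteq> Poly_Mapping.lookup b i"
    using assms by (meson poly_mapping_eqI)
  let ?z = "(\<chi> j. if j = i then 2 else 1) :: complex ^ 'n"
  have *: "mono_eval ?z c = 2 ^ Poly_Mapping.lookup c i" for c
  proof -
    have "mono_eval ?z c = (\<Prod>j\<in>UNIV. if j = i then 2 ^ Poly_Mapping.lookup c j else 1)"
      unfolding mono_eval_def by (intro prod.cong) auto
    then show ?thesis by simp
  qed
  have "(2::complex) ^ m = 2 ^ n \<longleftrightarrow> m = n" for m n :: nat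
  proof
    assume "(2::complex) ^ m = 2 ^ n"
    then have "norm ((2::complex) ^ m) = norm ((2::complex) ^ n)" by simp
    then have "(2::real) ^ m = 2 ^ n" by (simp add: norm_power)
    then show "m = n" by simp
  qed simp
  then show ?thesis
    using that[of ?z] i * by simp
qed

text \<open>Dedekind's argument: monomials are pairwise distinct characters of the multiplicative
  monoid \<open>\<complex>\<^sup>n\<close>, hence linearly independent.\<close>

lemma mono_eval_independent:
  assumes "finite A" "\<And>z. (\<Sum>a\<in>A. c a * mono_eval z a) = 0"
  shows "\<forall>a\<in>A. c a = 0"
  using assms
proof (induction A arbitrary: c)
  case (insert b A)
  have "\<forall>a\<in>A. c a = 0"
  proof
    fix a assume a: "a \<in> A"
    then obtain y where y: "mono_eval y a \<noteq> mono_eval y b"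
      using mono_eval_separates insert.hyps by metis
    have "(\<Sum>a\<in>A. c a * (mono_eval y a - mono_eval y b) * mono_eval z a) = 0" for z
    proof -
      have "(\<Sum>a\<in>A. c a * (mono_eval y a - mono_eval y b) * mono_eval z a)
        = (\<Sum>a\<in>insert b A. c a * (mono_eval y a - mono_eval y b) * mono_eval z a)"
        using insert.hyps by simp
      also have "\<dots> = (\<Sum>a\<in>insert b A. c a * mono_eval (\<chi> i. y $ i * z $ i) a)
          - mono_eval y b * (\<Sum>a\<in>insert b A. c a * mono_eval z a)"
        unfolding mono_eval_mult sum_distrib_left sum_subtractf[symmetric]
        by (intro sum.cong) (auto simp: algebra_simps)
      finally show ?thesis
        unfolding insert.prems by simp
    qed
    then have "\<forall>a\<in>A. c a * (mono_eval y a - mono_eval y b) = 0"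
      by (rule insert.IH)
    with a y show "c a = 0" by auto
  qed
  moreover have "c b = 0"
  proof -
    have "mono_eval (\<chi> i. 1) b = 1"
      by (simp add: mono_eval_def)
    with insert.prems[of "\<chi> i. 1"] insert.hyps \<open>\<forall>a\<in>A. c a = 0\<close> show ?thesis
      by simp
  qed
  ultimately show ?case by simp
qed simp

lemma poly_eval_eq_0_imp_eq_0:
  assumes "\<And>z. poly_eval f z = 0"
  shows "f = 0"
proof -
  have "\<forall>a\<in>Poly_Mapping.keys f. Poly_Mapping.lookup f a = 0"
    using assms mono_eval_independent[of "Poly_Mapping.keys f" "Poly_Mapping.lookup f"]
    by (simp add: poly_eval_eq_sum[OF _ order_refl])
  then have "Poly_Mapping.keys f = {}"
    unfolding in_keys_iff by blast
  then show ?thesis by simp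
qed

text \<open>Generating these functions by sums and products gives an induction on functions, without
  coefficients; restriction to lines, the chain rule and divided differences rest on it.\<close>

inductive polyfun :: "(complex ^ ('n::finite) \<Rightarrow> complex) \<Rightarrow> bool" where
  const [intro, simp]: "polyfun (\<lambda>z. c)"
| coord [intro, simp]: "polyfun (\<lambda>z. z $ i)"
| add [intro]: "polyfun f \<Longrightarrow> polyfun g \<Longrightarrow> polyfun (\<lambda>z. f z + g z)"
| mult [intro]: "polyfun f \<Longrightarrow> polyfun g \<Longrightarrow> polyfun (\<lambda>z. f z * g z)"

lemma polyfun_diff [intro]: "polyfun f \<Longrightarrow> polyfun g \<Longrightarrow> polyfun (\<lambda>z. f z - g z)"
  using polyfun.add[OF _ polyfun.mult[OF polyfun.const[of "-1"]], of f g] by simp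

lemma polyfun_sum [intro]: "(\<And>i. i \<in> A \<Longrightarrow> polyfun (f i)) \<Longrightarrow> polyfun (\<lambda>z. \<Sum>i\<in>A. f i z)"
  by (induction A rule: infinite_finite_induct) auto

lemma polyfun_prod [intro]: "(\<And>i. i \<in> A \<Longrightarrow> polyfun (f i)) \<Longrightarrow> polyfun (\<lambda>z. \<Prod>i\<in>A. f i z)"
  by (induction A rule: infinite_finite_induct) auto

lemma polyfun_power [intro]: "polyfun f \<Longrightarrow> polyfun (\<lambda>z. f z ^ n)"
  by (induction n) auto

lemma polyfun_poly_eval [intro, simp]: "polyfun (poly_eval f)"
proof -
  have "polyfun (\<lambda>z. poly_eval f z)"
    unfolding poly_eval_def by (intro polyfun_sum polyfun.mult polyfun_prod polyfun_power) auto
  then show ?thesis by simp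
qed

lemma polyfun_iff: "polyfun f \<longleftrightarrow> (\<exists>q. f = poly_eval q)"
proof
  assume "polyfun f"
  then show "\<exists>q. f = poly_eval q"
  proof induction
    case (const c)
    show ?case by (rule exI[of _ "const_poly c"]) auto
  next
    case (coord i)
    have "mono_eval z (Poly_Mapping.single i 1) = z $ i" for z :: "complex ^ 'a"
    proof -
      have "mono_eval z (Poly_Mapping.single i 1) = (\<Prod>j\<in>UNIV. if j = i then z $ j else 1)"
        unfolding mono_eval_def by (intro prod.cong) (auto simp: lookup_single when_def)
      then show ?thesis by simp
    qed
    then show ?case
      by (intro exI[of _ "Poly_Mapping.single (Poly_Mapping.single i 1) 1"]) auto
  next
    case (add f g)
    then obtain p q where "f = poly_eval p" "g = poly_eval q" by auto
    then show ?case by (intro exI[of _ "p + q"]) auto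
  next
    case (mult f g)
    then obtain p q where "f = poly_eval p" "g = poly_eval q" by auto
    then show ?case by (intro exI[of _ "p * q"]) auto
  qed
qed auto

lemma polyfun_compose:
  assumes "polyfun f" "\<And>j. polyfun (g j)"
  shows "polyfun (\<lambda>z. f (\<chi> j. g j z))"
  using assms(1) by induction (auto intro: assms(2))

lemma polyfun_compose_vec:
  assumes "polyfun f" "\<And>j. polyfun (\<lambda>z. g z $ j)"
  shows "polyfun (\<lambda>z. f (g z))"
  using polyfun_compose[of f "\<lambda>j z. g z $ j"] assms by simp

section \<open>Restriction to lines and generic points\<close>

lemma polyfun_along_line:
  assumes "polyfun f"
  obtains q where "\<And>t. f (a + t *s w) = poly q t"
proof -
  from assms have "\<exists>q. \<forall>t. f (a + t *s w) = poly q t"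
  proof induction
    case (const c)
    show ?case by (rule exI[of _ "[:c:]"]) simp
  next
    case (coord i)
    show ?case by (rule exI[of _ "[:a $ i, w $ i:]"]) simp
  next
    case (add f g)
    then obtain p q where "\<forall>t. f (a + t *s w) = poly p t" "\<forall>t. g (a + t *s w) = poly q t" by auto
    then show ?case by (intro exI[of _ "p + q"]) auto
  next
    case (mult f g)
    then obtain p q where "\<forall>t. f (a + t *s w) = poly p t" "\<forall>t. g (a + t *s w) = poly q t" by auto
    then show ?case by (intro exI[of _ "p * q"]) auto
  qed
  with that show ?thesis by blast
qed

text \<open>On the line through \<open>a\<close> and \<open>b\<close> both functions become nonzero
  polynomials in one variable, whose product is nonzero. Integrality and the irreducibility of
  affine space follow from this.\<close>

lemma polyfun_mult_nonzero:
  assumes "polyfun f" "polyfun g" "f a \<noteq> 0" "g b \<noteq> 0"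
  obtains z where "f z \<noteq> 0" "g z \<noteq> 0"
proof -
  obtain p where p: "\<And>t. f (a + t *s (b - a)) = poly p t"
    using polyfun_along_line[OF assms(1), of a "b - a"] by blast
  obtain q where q: "\<And>t. g (a + t *s (b - a)) = poly q t"
    using polyfun_along_line[OF assms(2), of a "b - a"] by blast
  have "poly p 0 \<noteq> 0" "poly q 1 \<noteq> 0"
    using p[of 0] q[of 1] assms by auto
  then have "p * q \<noteq> 0" by auto
  then obtain t where "poly (p * q) t \<noteq> 0"
    using poly_all_0_iff_0 by blast
  then show ?thesis
    using that[of "a + t *s (b - a)"] p q by auto
qed

lemma polyfun_mult_eq_0:
  assumes "polyfun f" "polyfun g" "\<And>z. f z * g z = 0" "f a \<noteq> 0"
  shows "g z = 0"
  using polyfun_mult_nonzero[OF assms(1,2,4), of z] assms(3) by (metis mult_eq_0_iff)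

text \<open>Source of every generic choice below; by integrality it suffices to look at the product
  of all the functions.\<close>

lemma polyfun_finite_common_nonzero:
  assumes "finite S" "\<And>s. s \<in> S \<Longrightarrow> polyfun (f s)" "\<And>s. s \<in> S \<Longrightarrow> \<exists>z. f s z \<noteq> 0"
  obtains z where "\<And>s. s \<in> S \<Longrightarrow> f s z \<noteq> 0"
proof -
  from assms have "\<exists>z. (\<Prod>s\<in>S. f s z) \<noteq> 0"
  proof (induction S)
    case (insert s S)
    then obtain b where "(\<Prod>s\<in>S. f s b) \<noteq> 0" by auto
    moreover obtain a where "f s a \<noteq> 0" using insert.prems by auto
    moreover have "polyfun (\<lambda>z. \<Prod>s\<in>S. f s z)" using insert by auto
    ultimately obtain z where "f s z \<noteq> 0" "(\<Prod>s\<in>S. f s z) \<noteq> 0"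
      using polyfun_mult_nonzero[of "f s" "\<lambda>z. \<Prod>s\<in>S. f s z"] insert.prems(1) by blast
    then show ?case using insert.hyps by auto
  qed simp
  with that show ?thesis using assms(1) by auto
qed

section \<open>Directional derivatives and the chain rule\<close>

definition dirderiv :: "(complex ^ ('n::finite) \<Rightarrow> complex) \<Rightarrow> complex ^ 'n \<Rightarrow> complex ^ 'n \<Rightarrow> complex"
  where "dirderiv f P w = deriv (\<lambda>t. f (P + t *s w)) 0"

text \<open>The coefficients \<open>g\<close> are chosen before the curve and its velocity
  \<open>w\<close>, so one gradient serves all curves through \<open>P\<close>, and the derivative
  is linear in \<open>w\<close> with no formula for partial derivatives.\<close>

lemma polyfun_chain_rule_gradient:
  assumes "polyfun f"
  shows "\<exists>g. \<forall>\<gamma> w. \<gamma> 0 = P \<longrightarrow> (\<forall>i. ((\<lambda>t. \<gamma> t $ i) has_field_derivative w $ i) (at 0)) \<longrightarrow>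
    ((\<lambda>t. f (\<gamma> t)) has_field_derivative (\<Sum>i\<in>UNIV. g i * w $ i)) (at 0)"
  using assms
proof induction
  case (const c)
  show ?case by (rule exI[of _ "\<lambda>_. 0"]) auto
next
  case (coord i)
  have *: "(\<Sum>j\<in>UNIV. (if j = i then 1 else 0) * w $ j) = w $ i" for w :: "complex ^ 'a"
    by (simp add: if_distrib[of "\<lambda>x. x * _"] cong: if_cong)
  show ?case
    by (rule exI[of _ "\<lambda>j. if j = i then 1 else 0"]) (simp only: *, blast)
next
  case (add f1 f2)
  then obtain g1 g2 where "\<forall>\<gamma> w. \<gamma> 0 = P \<longrightarrow> (\<forall>i. ((\<lambda>t. \<gamma> t $ i) has_field_derivative w $ i) (at 0)) \<longrightarrow>
      ((\<lambda>t. f1 (\<gamma> t)) has_field_derivative (\<Sum>i\<in>UNIV. g1 i * w $ i)) (at 0)"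
    "\<forall>\<gamma> w. \<gamma> 0 = P \<longrightarrow> (\<forall>i. ((\<lambda>t. \<gamma> t $ i) has_field_derivative w $ i) (at 0)) \<longrightarrow>
      ((\<lambda>t. f2 (\<gamma> t)) has_field_derivative (\<Sum>i\<in>UNIV. g2 i * w $ i)) (at 0)" by blast
  then show ?case
    by (intro exI[of _ "\<lambda>i. g1 i + g2 i"]) (auto simp: distrib_right sum.distrib intro!: DERIV_add)
next
  case (mult f1 f2)
  then obtain g1 g2 where *: "\<forall>\<gamma> w. \<gamma> 0 = P \<longrightarrow> (\<forall>i. ((\<lambda>t. \<gamma> t $ i) has_field_derivative w $ i) (at 0)) \<longrightarrow>
      ((\<lambda>t. f1 (\<gamma> t)) has_field_derivative (\<Sum>i\<in>UNIV. g1 i * w $ i)) (at 0)"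
    "\<forall>\<gamma> w. \<gamma> 0 = P \<longrightarrow> (\<forall>i. ((\<lambda>t. \<gamma> t $ i) has_field_derivative w $ i) (at 0)) \<longrightarrow>
      ((\<lambda>t. f2 (\<gamma> t)) has_field_derivative (\<Sum>i\<in>UNIV. g2 i * w $ i)) (at 0)" by blast
  show ?case
  proof (intro exI[of _ "\<lambda>i. g1 i * f2 P + g2 i * f1 P"] allI impI)
    fix \<gamma> and w :: "complex ^ 'a"
    assume "\<gamma> 0 = P" "\<forall>i. ((\<lambda>t. \<gamma> t $ i) has_field_derivative w $ i) (at 0)"
    with * have "((\<lambda>t. f1 (\<gamma> t) * f2 (\<gamma> t)) has_field_derivative
        (\<Sum>i\<in>UNIV. g1 i * w $ i) * f2 (\<gamma> 0) + (\<Sum>i\<in>UNIV. g2 i * w $ i) * f1 (\<gamma> 0)) (at 0)"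
      by (intro DERIV_mult) auto
    with \<open>\<gamma> 0 = P\<close> show "((\<lambda>t. f1 (\<gamma> t) * f2 (\<gamma> t)) has_field_derivative
        (\<Sum>i\<in>UNIV. (g1 i * f2 P + g2 i * f1 P) * w $ i)) (at 0)"
      by (simp add: algebra_simps sum.distrib sum_distrib_left)
  qed
qed

lemma dirderiv_eq_gradient:
  assumes "polyfun f"
  obtains g where "\<And>w. dirderiv f P w = (\<Sum>i\<in>UNIV. g i * w $ i)"
    and "\<And>\<gamma> w. \<gamma> 0 = P \<Longrightarrow> (\<And>i. ((\<lambda>t. \<gamma> t $ i) has_field_derivative w $ i) (at 0)) \<Longrightarrow>
    ((\<lambda>t. f (\<gamma> t)) has_field_derivative (\<Sum>i\<in>UNIV. g i * w $ i)) (at 0)"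
proof -
  obtain g where g: "\<And>\<gamma> w. \<gamma> 0 = P \<Longrightarrow> (\<And>i. ((\<lambda>t. \<gamma> t $ i) has_field_derivative w $ i) (at 0)) \<Longrightarrow>
    ((\<lambda>t. f (\<gamma> t)) has_field_derivative (\<Sum>i\<in>UNIV. g i * w $ i)) (at 0)"
    using polyfun_chain_rule_gradient[OF assms, of P] by blast
  have "dirderiv f P w = (\<Sum>i\<in>UNIV. g i * w $ i)" for w
    unfolding dirderiv_def
    by (intro DERIV_imp_deriv g) (auto intro!: derivative_eq_intros)
  with g that show ?thesis by blast
qed

lemma polyfun_chain_rule:
  assumes "polyfun f" "\<gamma> 0 = P" "\<And>i. ((\<lambda>t. \<gamma> t $ i) has_field_derivative w $ i) (at 0)"
  shows "((\<lambda>t. f (\<gamma> t)) has_field_derivative dirderiv f P w) (at 0)"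
  using dirderiv_eq_gradient[OF assms(1), of P] assms(2,3) by metis

lemma dirderiv_line:
  assumes "polyfun f"
  shows "((\<lambda>t. f (P + t *s w)) has_field_derivative dirderiv f P w) (at 0)"
  by (rule polyfun_chain_rule[OF assms]) (auto intro!: derivative_eq_intros)

lemma dirderiv_add:
  assumes "polyfun f"
  shows "dirderiv f P (v + w) = dirderiv f P v + dirderiv f P w"
proof -
  obtain g where g: "\<And>w. dirderiv f P w = (\<Sum>i\<in>UNIV. g i * w $ i)"
    using dirderiv_eq_gradient[OF assms, of P] by metis
  show ?thesis by (simp add: g distrib_left sum.distrib)
qed

lemma dirderiv_scale:
  assumes "polyfun f"
  shows "dirderiv f P (c *s w) = c * dirderiv f P w"
proof -
  obtain g where g: "\<And>w. dirderiv f P w = (\<Sum>i\<in>UNIV. g i * w $ i)"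
    using dirderiv_eq_gradient[OF assms, of P] by metis
  show ?thesis by (simp add: g sum_distrib_left mult_ac)
qed

lemma polyfun_dirderiv:
  assumes "polyfun f"
  shows "polyfun (\<lambda>w. dirderiv f P w)"
proof -
  obtain g where g: "\<And>w. dirderiv f P w = (\<Sum>i\<in>UNIV. g i * w $ i)"
    using dirderiv_eq_gradient[OF assms, of P] by metis
  show ?thesis unfolding g by (intro polyfun_sum polyfun.mult) auto
qed

section \<open>Chains of irreducible closed sets\<close>

lemma homogeneous_system_nontrivial_solution:
  fixes M :: "'a \<Rightarrow> 'b \<Rightarrow> 'c::field"
  assumes "finite B" "finite A" "card B < card A"
  shows "\<exists>c. (\<exists>a\<in>A. c a \<noteq> 0) \<and> (\<forall>b\<in>B. (\<Sum>a\<in>A. c a * M a b) = 0)"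
  using assms
proof (induction B arbitrary: A M)
  case empty
  then have "A \<noteq> {}" by auto
  then show ?case by (intro exI[of _ "\<lambda>_. 1"]) auto
next
  case (insert b B)
  show ?case
  proof (cases "\<forall>a\<in>A. M a b = 0")
    case True
    have "card B < card A" using insert by simp
    then show ?thesis using insert.IH[of A M] insert.prems True by auto
  next
    case False
    then obtain a0 where a0: "a0 \<in> A" "M a0 b \<noteq> 0" by auto
    let ?A = "A - {a0}"
    \<comment> \<open>Gaussian elimination: equation \<open>b\<close> is solved for the unknown at
      the pivot \<open>a0\<close> and substituted into the others; \<open>?s\<close> is the value
      that it forces.\<close>
    let ?M = "\<lambda>a b'. M a b' - M a b / M a0 b * M a0 b'"
    have "card B < card ?A" using insert a0 by simp
    then obtain c where c: "\<exists>a\<in>?A. c a \<noteq> 0" "\<forall>b'\<in>B. (\<Sum>a\<in>?A. c a * ?M a b') = 0"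
      using insert.IH[of ?A ?M] insert.prems by auto
    let ?s = "- (\<Sum>a\<in>?A. c a * M a b / M a0 b)"
    let ?c = "c(a0 := ?s)"
    have split: "(\<Sum>a\<in>A. ?c a * M a b') = ?s * M a0 b' + (\<Sum>a\<in>?A. c a * M a b')" for b'
      using a0 insert.prems by (subst sum.remove[of A a0]) auto
    have "(\<Sum>a\<in>A. ?c a * M a b') = 0" if "b' \<in> insert b B" for b'
    proof (cases "b' = b")
      case True
      then show ?thesis unfolding split using a0
        by (simp add: sum_distrib_right)
    next
      case False
      then have "0 = (\<Sum>a\<in>?A. c a * ?M a b')" using c that by auto
      also have "\<dots> = (\<Sum>a\<in>A. ?c a * M a b')"
        unfolding split by (simp add: sum_distrib_left sum_subtractf algebra_simps)
      finally show ?thesis by simp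
    qed
    moreover have "\<exists>a\<in>A. ?c a \<noteq> 0" using c by auto
    ultimately show ?thesis by blast
  qed
qed

section \<open>Zariski closed and irreducible sets\<close>

lemma zariski_closed_zero_set:
  assumes "polyfun f"
  shows "zariski_closed {z. f z = 0}"
proof -
  obtain q where "f = poly_eval q" using assms polyfun_iff by blast
  then show ?thesis unfolding zariski_closed_def by (intro exI[of _ "{q}"]) auto
qed

lemma zariski_irreducible_mult_eq_0:
  assumes "zariski_irreducible Z" "polyfun f" "polyfun g" "\<And>z. z \<in> Z \<Longrightarrow> f z * g z = 0"
  shows "(\<forall>z\<in>Z. f z = 0) \<or> (\<forall>z\<in>Z. g z = 0)"
proof -
  have "Z \<subseteq> {z. f z = 0} \<union> {z. g z = 0}" using assms(4) by auto
  then have "Z \<subseteq> {z. f z = 0} \<or> Z \<subseteq> {z. g z = 0}"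
    using assms(1) zariski_closed_zero_set[OF assms(2)] zariski_closed_zero_set[OF assms(3)]
    unfolding zariski_irreducible_def by blast
  then show ?thesis by auto
qed

lemma zariski_closed_UNIV: "zariski_closed UNIV"
  unfolding zariski_closed_def by (intro exI[of _ "{}"]) auto

lemma zariski_irreducible_UNIV: "zariski_irreducible (UNIV :: (complex ^ 'n::finite) set)"
  unfolding zariski_irreducible_def
proof (intro conjI allI impI)
  fix A B :: "(complex ^ 'n) set"
  assume "zariski_closed A" "zariski_closed B" and cover: "UNIV \<subseteq> A \<union> B"
  then obtain F G where F: "A = {z. \<forall>f\<in>F. poly_eval f z = 0}" and G: "B = {z. \<forall>f\<in>G. poly_eval f z = 0}"
    unfolding zariski_closed_def by auto
  show "UNIV \<subseteq> A \<or> UNIV \<subseteq> B"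
  proof (rule ccontr)
    assume "\<not> (UNIV \<subseteq> A \<or> UNIV \<subseteq> B)"
    then obtain a b where "a \<notin> A" "b \<notin> B" by auto
    then obtain f g where fg: "f \<in> F" "g \<in> G" "poly_eval f a \<noteq> 0" "poly_eval g b \<noteq> 0"
      using F G by auto
    then obtain z where "poly_eval f z \<noteq> 0" "poly_eval g z \<noteq> 0"
      using polyfun_mult_nonzero[of "poly_eval f" "poly_eval g" a b] by auto
    then have "z \<notin> A \<union> B" using fg F G by auto
    then show False using cover by auto
  qed
qed simp

text \<open>The head of the list is the exponent of the function of highest index, this index being
  the length of the tail. Dropping the head thus passes from \<open>F 0, ..., F n\<close> to
  \<open>F 0, ..., F (n - 1)\<close>, one step down the chain.\<close>

fun power_product :: "(nat \<Rightarrow> 'r::comm_monoid_mult) \<Rightarrow> nat list \<Rightarrow> 'r" where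
  "power_product F [] = 1"
| "power_product F (a # as) = F (length as) ^ a * power_product F as"

definition exponents :: "nat \<Rightarrow> nat \<Rightarrow> nat list set"
  where "exponents d n = {as. set as \<subseteq> {..d} \<and> length as = n}"

lemma finite_exponents [simp]: "finite (exponents d n)"
  unfolding exponents_def by (rule finite_lists_length_eq) simp

lemma card_exponents: "card (exponents d n) = Suc d ^ n"
  unfolding exponents_def by (subst card_lists_length_eq) auto

lemma sum_exponents_Suc:
  "(\<Sum>as\<in>exponents d (Suc n). g as) = (\<Sum>a\<le>d. \<Sum>as\<in>exponents d n. g (a # as))"
proof -
  have "exponents d (Suc n) = (\<lambda>(a, as). a # as) ` ({..d} \<times> exponents d n)"
    unfolding exponents_def by (auto simp: length_Suc_conv image_iff)
  moreover have "inj_on (\<lambda>(a, as). a # as) ({..d} \<times> exponents d n)"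
    by (auto simp: inj_on_def)
  ultimately show ?thesis
    by (simp add: sum.reindex sum.cartesian_product case_prod_unfold)
qed

text \<open>If \<open>F i\<close> vanishes on \<open>Z i\<close> but not on \<open>Z (i + 1)\<close>, then \<open>F 0, \<dots>, F (n - 1)\<close> are algebraically
  independent on \<open>Z n\<close>: in a relation of least order in \<open>F (n - 1)\<close>, that power can be cancelled by
  irreducibility, and restricting to \<open>Z (n - 1)\<close> leaves a relation between the other functions.\<close>

lemma chain_power_products_independent:
  fixes F :: "nat \<Rightarrow> ('n::finite) cpoly"
  assumes irr: "\<And>i. i \<le> N \<Longrightarrow> zariski_irreducible (Z i)"
    and zero: "\<And>i z. i < N \<Longrightarrow> z \<in> Z i \<Longrightarrow> poly_eval (F i) z = 0"
    and nonzero: "\<And>i. i < N \<Longrightarrow> \<exists>z\<in>Z (Suc i). poly_eval (F i) z \<noteq> 0"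
    and sub: "\<And>i. i < N \<Longrightarrow> Z i \<subseteq> Z (Suc i)"
    and "n \<le> N"
    and "\<And>z. z \<in> Z n \<Longrightarrow> (\<Sum>as\<in>exponents d n. c as * poly_eval (power_product F as) z) = 0"
  shows "\<forall>as\<in>exponents d n. c as = 0"
  using assms(5,6)
proof (induction n arbitrary: c)
  case 0
  have *: "exponents d 0 = {[]}" by (auto simp: exponents_def)
  obtain z where "z \<in> Z 0" using irr[of 0] unfolding zariski_irreducible_def by auto
  from 0(2)[OF this] show ?case by (simp add: *)
next
  case (Suc n)
  define G where "G a z = (\<Sum>as\<in>exponents d n. c (a # as) * poly_eval (power_product F as) z)" for a z
  let ?f = "poly_eval (F n)"
  have polyG [intro]: "polyfun (G a)" for a
  proof -
    have "polyfun (\<lambda>z. G a z)"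
      unfolding G_def by (intro polyfun_sum polyfun.mult) auto
    then show ?thesis by simp
  qed
  have rel: "(\<Sum>b\<le>d. ?f z ^ b * G b z) = 0" if "z \<in> Z (Suc n)" for z
  proof -
    have "(\<Sum>b\<le>d. ?f z ^ b * G b z)
        = (\<Sum>as\<in>exponents d (Suc n). c as * poly_eval (power_product F as) z)"
      unfolding sum_exponents_Suc G_def sum_distrib_left
      by (intro sum.cong refl) (simp add: exponents_def mult_ac)
    then show ?thesis using Suc.prems that by simp
  qed
  have "\<forall>as\<in>exponents d n. c (a # as) = 0" if "a \<le> d" for a
    using that
  proof (induction a rule: less_induct)
    case (less a)
    then have G0: "G b z = 0" if "b < a" for b z
      using that unfolding G_def by (intro sum.neutral) auto
    \<comment> \<open>The coefficients \<open>G a\<close> are killed in increasing order of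
      \<open>a\<close>. As \<open>G b\<close> is zero for \<open>b < a\<close>, the relation is
      divisible by \<open>?f z ^ a\<close>, and \<open>R\<close> is the quotient.\<close>
    define R where "R z = (\<Sum>b\<in>{a..d}. ?f z ^ (b - a) * G b z)" for z
    have "?f z ^ a * R z = 0" if "z \<in> Z (Suc n)" for z
    proof -
      have "?f z ^ a * R z = (\<Sum>b\<in>{a..d}. ?f z ^ b * G b z)"
        unfolding R_def sum_distrib_left
        by (intro sum.cong refl) (simp add: mult.assoc[symmetric] power_add[symmetric])
      also have "\<dots> = (\<Sum>b\<le>d. ?f z ^ b * G b z)"
        by (intro sum.mono_neutral_left) (auto simp: G0)
      finally show ?thesis using rel[OF that] by simp
    qed
    moreover have "polyfun R"
    proof -
      have "polyfun (\<lambda>z. R z)"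
        unfolding R_def by (intro polyfun_sum polyfun.mult polyfun_power) auto
      then show ?thesis by simp
    qed
    moreover have "zariski_irreducible (Z (Suc n))" using irr Suc.prems by simp
    ultimately have "(\<forall>z\<in>Z (Suc n). ?f z ^ a = 0) \<or> (\<forall>z\<in>Z (Suc n). R z = 0)"
      by (intro zariski_irreducible_mult_eq_0) auto
    moreover have "\<not> (\<forall>z\<in>Z (Suc n). ?f z ^ a = 0)"
      using nonzero[of n] Suc.prems by auto
    ultimately have R0: "R z = 0" if "z \<in> Z n" for z
      using that sub[of n] Suc.prems by auto
    have "G a z = 0" if "z \<in> Z n" for z
    proof -
      have "?f z = 0" using zero[of n z] Suc.prems that by simp
      then have "R z = (\<Sum>b\<in>{a..d}. if b = a then G a z else 0)"
        unfolding R_def by (intro sum.cong refl) auto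
      also have "\<dots> = G a z" using less.prems by simp
      finally show ?thesis using R0 that by simp
    qed
    then show ?case
      using Suc.IH[of "\<lambda>as. c (a # as)"] Suc.prems(1) unfolding G_def by simp
  qed
  then show ?case
    by (auto simp: exponents_def length_Suc_conv)
qed

text \<open>A bound on each exponent separately, not on the total degree: the admissible monomials
  then fill a box, which is easy to count.\<close>

definition exponents_bounded :: "nat \<Rightarrow> 'n cpoly \<Rightarrow> bool"
  where "exponents_bounded e f \<longleftrightarrow> (\<forall>a\<in>Poly_Mapping.keys f. \<forall>i. Poly_Mapping.lookup a i \<le> e)"

lemma exponents_bounded_mono: "exponents_bounded e f \<Longrightarrow> e \<le> e' \<Longrightarrow> exponents_bounded e' f"
  unfolding exponents_bounded_def by (meson order_trans)

lemma exponents_bounded_1: "exponents_bounded 0 1"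
  by (simp add: exponents_bounded_def)

lemma exponents_bounded_mult:
  assumes "exponents_bounded e f" "exponents_bounded e' g"
  shows "exponents_bounded (e + e') (f * g)"
  unfolding exponents_bounded_def
proof (intro ballI allI)
  fix a i assume "a \<in> Poly_Mapping.keys (f * g)"
  then obtain b c where "a = b + c" "b \<in> Poly_Mapping.keys f" "c \<in> Poly_Mapping.keys g"
    using keys_mult by blast
  then show "Poly_Mapping.lookup a i \<le> e + e'"
    using assms unfolding exponents_bounded_def by (simp add: lookup_add add_mono)
qed

lemma exponents_bounded_power: "exponents_bounded e f \<Longrightarrow> exponents_bounded (n * e) (f ^ n)"
  by (induction n) (auto intro: exponents_bounded_1 exponents_bounded_mult)

lemma exponents_bounded_ex: "\<exists>e. exponents_bounded e (f :: ('n::finite) cpoly)"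
proof -
  let ?S = "(\<lambda>(a, i). Poly_Mapping.lookup a i) ` (Poly_Mapping.keys f \<times> UNIV)"
  have "finite ?S" by simp
  then have "exponents_bounded (Max ?S) f"
    unfolding exponents_bounded_def by (auto intro!: Max_ge)
  then show ?thesis by blast
qed

lemma exponents_bounded_power_product:
  assumes "\<And>i. i < n \<Longrightarrow> exponents_bounded e (F i)" "as \<in> exponents d n"
  shows "exponents_bounded (n * (d * e)) (power_product F as)"
  using assms
proof (induction n arbitrary: as)
  case 0
  then show ?case by (simp add: exponents_def exponents_bounded_1)
next
  case (Suc n)
  then obtain a bs where as: "as = a # bs" "a \<le> d" "bs \<in> exponents d n"
    unfolding exponents_def by (auto simp: length_Suc_conv)
  have "exponents_bounded (d * e) (F n ^ a)"
    using exponents_bounded_power[of e "F n" a] Suc.prems(1)[of n] as(2)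
    by (auto elim: exponents_bounded_mono)
  moreover have "exponents_bounded (n * (d * e)) (power_product F bs)"
    using Suc as by simp
  ultimately show ?case
    using exponents_bounded_mult[of "d * e" "F n ^ a" "n * (d * e)" "power_product F bs"] as
    by (simp add: exponents_def)
qed

lemma finite_card_bounded_monomials:
  defines "E \<equiv> \<lambda>e. {a :: ('n::finite) \<Rightarrow>\<^sub>0 nat. \<forall>i. Poly_Mapping.lookup a i \<le> e}"
  shows "finite (E e)" "card (E e) \<le> Suc e ^ CARD('n)"
proof -
  let ?P = "PiE (UNIV :: 'n set) (\<lambda>_. {..e})"
  have inj: "inj_on Poly_Mapping.lookup (E e)"
    by (rule inj_onI) (simp add: poly_mapping_eqI)
  have sub: "Poly_Mapping.lookup ` E e \<subseteq> ?P"
    unfolding E_def by auto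
  have fin: "finite ?P" by (simp add: finite_PiE)
  show "finite (E e)"
    using finite_imageD[OF finite_subset[OF sub fin] inj] .
  have "card (E e) \<le> card ?P"
    using card_inj_on_le[OF inj sub fin] .
  then show "card (E e) \<le> Suc e ^ CARD('n)"
    by (simp add: card_PiE)
qed

text \<open>In a longer chain, n = \<open>CARD('n)\<close> + 1 of the polynomials separating
  consecutive members would be algebraically independent. But the (d + 1)^n power products with
  exponents up to d involve at most (nde + 1)^(n - 1) monomials, where e bounds the exponents of the
  factors; for large d they are linearly dependent.\<close>

lemma irreducible_chain_length_le:
  fixes Z :: "nat \<Rightarrow> (complex ^ ('n::finite)) set"
  assumes closed: "\<And>i. i \<le> N \<Longrightarrow> zariski_closed (Z i)"
    and irr: "\<And>i. i \<le> N \<Longrightarrow> zariski_irreducible (Z i)"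
    and strict: "\<And>i. i < N \<Longrightarrow> Z i \<subset> Z (Suc i)"
  shows "N \<le> CARD('n)"
proof (rule ccontr)
  define n where "n = Suc CARD('n)"
  assume "\<not> N \<le> CARD('n)"
  then have nN: "n \<le> N" by (simp add: n_def)
  have "\<forall>i. \<exists>f. i < N \<longrightarrow> (\<forall>z\<in>Z i. poly_eval f z = 0) \<and> (\<exists>z\<in>Z (Suc i). poly_eval f z \<noteq> 0)"
  proof (rule allI)
    fix i
    show "\<exists>f. i < N \<longrightarrow> (\<forall>z\<in>Z i. poly_eval f z = 0) \<and> (\<exists>z\<in>Z (Suc i). poly_eval f z \<noteq> 0)"
    proof (cases "i < N")
      case True
      then obtain S where S: "Z i = {z. \<forall>f\<in>S. poly_eval f z = 0}"
        using closed[of i] unfolding zariski_closed_def by auto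
      obtain z where "z \<in> Z (Suc i)" "z \<notin> Z i" using strict[OF True] by auto
      with S show ?thesis by auto
    qed simp
  qed
  from choice[OF this] obtain F where F: "\<And>i z. i < N \<Longrightarrow> z \<in> Z i \<Longrightarrow> poly_eval (F i) z = 0"
      "\<And>i. i < N \<Longrightarrow> \<exists>z\<in>Z (Suc i). poly_eval (F i) z \<noteq> 0"
    by blast
  obtain e' where e': "\<And>i. exponents_bounded (e' i) (F i)"
    using choice[of "\<lambda>i e. exponents_bounded e (F i)"] exponents_bounded_ex by blast
  define e where "e = (\<Sum>i<n. e' i)"
  have e: "exponents_bounded e (F i)" if "i < n" for i
    using exponents_bounded_mono[OF e'[of i], of e] that unfolding e_def
    by (simp add: member_le_sum)
  \<comment> \<open>With k = \<open>CARD('n)\<close> this value gives (nde + 1)^k \<le> ((ne + 1)(d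
    + 1))^k = d (d + 1)^k < (d + 1)^(k + 1).\<close>
  define d where "d = (n * e + 1) ^ CARD('n)"
  let ?A = "exponents d n"
  let ?B = "{a :: 'n \<Rightarrow>\<^sub>0 nat. \<forall>i. Poly_Mapping.lookup a i \<le> n * (d * e)}"
  have "Suc (n * (d * e)) \<le> (n * e + 1) * Suc d" by (simp add: algebra_simps)
  then have "Suc (n * (d * e)) ^ CARD('n) \<le> ((n * e + 1) * Suc d) ^ CARD('n)"
    by (rule power_mono) simp
  also have "\<dots> = d * Suc d ^ CARD('n)"
    by (simp only: power_mult_distrib d_def)
  also have "\<dots> < Suc d ^ n" by (simp add: n_def)
  finally have "card ?B < card ?A"
    using finite_card_bounded_monomials(2)[of "n * (d * e)", where 'n='n] by (simp add: card_exponents)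
  then obtain c where c: "\<exists>as\<in>?A. c as \<noteq> 0"
      "\<forall>b\<in>?B. (\<Sum>as\<in>?A. c as * Poly_Mapping.lookup (power_product F as) b) = 0"
    using homogeneous_system_nontrivial_solution[OF finite_card_bounded_monomials(1) finite_exponents,
      of "n * (d * e)" d n "\<lambda>as. Poly_Mapping.lookup (power_product F as)"] by blast
  have "(\<Sum>as\<in>?A. c as * poly_eval (power_product F as) z) = 0" for z
  proof -
    have "(\<Sum>as\<in>?A. c as * poly_eval (power_product F as) z)
        = (\<Sum>as\<in>?A. \<Sum>b\<in>?B. c as * Poly_Mapping.lookup (power_product F as) b * mono_eval z b)"
    proof (intro sum.cong refl)
      fix as assume "as \<in> ?A"
      then have "exponents_bounded (n * (d * e)) (power_product F as)"
        by (intro exponents_bounded_power_product e)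
      then have "Poly_Mapping.keys (power_product F as) \<subseteq> ?B"
        unfolding exponents_bounded_def by auto
      then show "c as * poly_eval (power_product F as) z
          = (\<Sum>b\<in>?B. c as * Poly_Mapping.lookup (power_product F as) b * mono_eval z b)"
        by (simp add: poly_eval_eq_sum[OF finite_card_bounded_monomials(1)] sum_distrib_left mult.assoc)
    qed
    also have "\<dots> = (\<Sum>b\<in>?B. (\<Sum>as\<in>?A. c as * Poly_Mapping.lookup (power_product F as) b) * mono_eval z b)"
      by (subst sum.swap) (simp add: sum_distrib_right)
    also have "\<dots> = 0" using c(2) by simp
    finally show ?thesis .
  qed
  then have "\<forall>as\<in>?A. c as = 0"
    using strict by (intro chain_power_products_independent[where N=N and Z=Z and F=F and n=n and d=d and c=c] irr F nN) auto
  with c(1) show False by auto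
qed

text \<open>A chain inside a proper subset can be prolonged by the whole space, which is closed and
  irreducible, so it is one step shorter than the general bound permits.\<close>

lemma local_dim_less:
  fixes X :: "(complex ^ ('n::finite)) set"
  assumes "X \<noteq> UNIV"
  shows "local_dim X P < enat CARD('n)"
proof -
  have "local_dim X P \<le> enat (CARD('n) - 1)"
    unfolding local_dim_def
  proof (rule SUP_least, clarsimp)
    fix d and Z :: "nat \<Rightarrow> (complex ^ 'n) set"
    assume Z: "\<forall>i\<le>d. zariski_closed (Z i) \<and> zariski_irreducible (Z i) \<and> P \<in> Z i \<and> Z i \<subseteq> X"
      "\<forall>i<d. Z i \<subset> Z (Suc i)"
    define Z' where "Z' i = (if i \<le> d then Z i else UNIV)" for i
    have "Suc d \<le> CARD('n)"
    proof (rule irreducible_chain_length_le[of _ Z'])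
      show "zariski_closed (Z' i)" "zariski_irreducible (Z' i)" for i
        using Z zariski_closed_UNIV zariski_irreducible_UNIV by (auto simp: Z'_def)
      show "Z' i \<subset> Z' (Suc i)" if "i < Suc d" for i
      proof (cases "i = d")
        case True
        then have "Z i \<subseteq> X" using Z by simp
        then show ?thesis using True assms by (auto simp: Z'_def)
      next
        case False
        then show ?thesis using Z that by (simp add: Z'_def)
      qed
    qed
    then show "d \<le> CARD('n) - Suc 0" by simp
  qed
  also have "\<dots> < enat CARD('n)" by simp
  finally show ?thesis .
qed

section \<open>Automorphisms preserve the singular locus\<close>

definition polymap :: "(complex ^ ('n::finite) \<Rightarrow> complex ^ ('m::finite)) \<Rightarrow> bool"
  where "polymap G \<longleftrightarrow> (\<forall>j. polyfun (\<lambda>z. G z $ j))"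

lemma polyfun_polymap: "polyfun f \<Longrightarrow> polymap G \<Longrightarrow> polyfun (\<lambda>z. f (G z))"
  unfolding polymap_def by (rule polyfun_compose_vec) auto

lemma polymap_comp: "polymap H \<Longrightarrow> polymap G \<Longrightarrow> polymap (\<lambda>z. H (G z))"
  unfolding polymap_def[of H] polymap_def[of "\<lambda>z. H (G z)"] by (auto intro: polyfun_polymap)

lemma regular_map_iff:
  "regular_map X Y g \<longleftrightarrow> g ` X \<subseteq> Y \<and> (\<exists>G. polymap G \<and> (\<forall>z\<in>X. g z = G z))"
proof -
  have "(\<exists>q. \<forall>z\<in>X. \<forall>j. g z $ j = poly_eval (q j) z) \<longleftrightarrow> (\<exists>G. polymap G \<and> (\<forall>z\<in>X. g z = G z))"
  proof
    assume "\<exists>q. \<forall>z\<in>X. \<forall>j. g z $ j = poly_eval (q j) z"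
    then obtain q where "\<forall>z\<in>X. \<forall>j. g z $ j = poly_eval (q j) z" by blast
    then show "\<exists>G. polymap G \<and> (\<forall>z\<in>X. g z = G z)"
      by (intro exI[of _ "\<lambda>z. \<chi> j. poly_eval (q j) z"]) (auto simp: polymap_def vec_eq_iff)
  next
    assume "\<exists>G. polymap G \<and> (\<forall>z\<in>X. g z = G z)"
    then obtain G where G: "polymap G" "\<forall>z\<in>X. g z = G z" by blast
    then have "\<forall>j. \<exists>q. (\<lambda>z. G z $ j) = poly_eval q"
      unfolding polymap_def polyfun_iff by blast
    then obtain q where "\<And>j. (\<lambda>z. G z $ j) = poly_eval (q j)" by metis
    then have "G z $ j = poly_eval (q j) z" for z j by metis
    with G show "\<exists>q. \<forall>z\<in>X. \<forall>j. g z $ j = poly_eval (q j) z" by metis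
  qed
  then show ?thesis by (simp add: regular_map_def)
qed

section \<open>Tangent spaces and local dimension under polynomial maps\<close>

lemma mem_tangent_space_iff:
  "w \<in> tangent_space X P \<longleftrightarrow> (\<forall>f. polyfun f \<longrightarrow> (\<forall>z\<in>X. f z = 0) \<longrightarrow> dirderiv f P w = 0)"
  unfolding tangent_space_def vanishing_ideal_def dirderiv_def polyfun_iff by auto

definition differential ::
    "(complex ^ ('n::finite) \<Rightarrow> complex ^ ('m::finite)) \<Rightarrow> complex ^ 'n \<Rightarrow> complex ^ 'n \<Rightarrow> complex ^ 'm"
  where "differential G P w = (\<chi> j. dirderiv (\<lambda>z. G z $ j) P w)"

lemma dirderiv_compose:
  assumes "polyfun f" "polymap G"
  shows "dirderiv (\<lambda>z. f (G z)) P w = dirderiv f (G P) (differential G P w)"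
proof -
  have "((\<lambda>t. f (G (P + t *s w))) has_field_derivative dirderiv f (G P) (differential G P w)) (at 0)"
    using assms(2) unfolding polymap_def differential_def
    by (intro polyfun_chain_rule[OF assms(1)]) (auto intro: dirderiv_line)
  then show ?thesis
    unfolding dirderiv_def[of "\<lambda>z. f (G z)"] by (rule DERIV_imp_deriv)
qed

lemma linear_differential:
  assumes "polymap G"
  shows "Vector_Spaces.linear (*s) (*s) (differential G P)"
  using assms unfolding polymap_def
  by unfold_locales (auto simp: differential_def vec_eq_iff dirderiv_add dirderiv_scale algebra_simps)

lemma differential_tangent_space:
  assumes "polymap G" "\<And>z. z \<in> X \<Longrightarrow> G z \<in> Y"
  shows "differential G P ` tangent_space X P \<subseteq> tangent_space Y (G P)"
  using assms unfolding mem_tangent_space_iff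
  by (auto simp: mem_tangent_space_iff dirderiv_compose[symmetric] polyfun_polymap)

text \<open>\<open>H (G z) - z\<close> vanishes on \<open>X\<close>, so its differential kills the
  tangent space at \<open>P\<close>: there the differential of \<open>H\<close> at
  \<open>G P\<close> undoes that of \<open>G\<close>, although the maps need not be inverse outside
  \<open>X\<close>.\<close>

lemma dim_tangent_space_le:
  assumes "polymap G" "polymap H" "\<And>z. z \<in> X \<Longrightarrow> G z \<in> Y" "\<And>z. z \<in> X \<Longrightarrow> H (G z) = z"
    and "P \<in> X"
  shows "vec.dim (tangent_space X P) \<le> vec.dim (tangent_space Y (G P))"
proof -
  have inv: "differential H (G P) (differential G P w) = w" if w: "w \<in> tangent_space X P" for w
  proof (rule vec_eq_iff[THEN iffD2], rule allI)
    fix j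
    have poly: "polyfun (\<lambda>z. H z $ j)" "polyfun (\<lambda>z. H (G z) $ j - z $ j)"
      using assms polymap_comp[of H G] by (auto simp: polymap_def)
    then have "dirderiv (\<lambda>z. H (G z) $ j - z $ j) P w = 0"
      using w assms(4) unfolding mem_tangent_space_iff by auto
    moreover have deriv: "((\<lambda>t. H (G (P + t *s w)) $ j - (P + t *s w) $ j) has_field_derivative
        dirderiv (\<lambda>z. H z $ j) (G P) (differential G P w) - w $ j) (at 0)"
      using dirderiv_line[OF polyfun_polymap[OF poly(1) assms(1)], of P w]
        dirderiv_compose[OF poly(1) assms(1), of P w]
      by (intro DERIV_diff) (auto intro!: derivative_eq_intros)
    from DERIV_imp_deriv[OF deriv]
    have eq: "dirderiv (\<lambda>z. H (G z) $ j - z $ j) P w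
        = dirderiv (\<lambda>z. H z $ j) (G P) (differential G P w) - w $ j"
      unfolding dirderiv_def[of "\<lambda>z. H (G z) $ j - z $ j"] .
    ultimately show "differential H (G P) (differential G P w) $ j = w $ j"
      using eq by (simp add: differential_def[of H])
  qed
  let ?T = "differential G P ` tangent_space X P"
  have "tangent_space X P = differential H (G P) ` ?T"
    using inv by (force simp: image_iff)
  then have "vec.dim (tangent_space X P) \<le> vec.dim ?T"
    using vec.dim_image_le[OF linear_differential[OF assms(2)], of "G P" ?T] by simp
  also have "\<dots> \<le> vec.dim (tangent_space Y (G P))"
    by (intro vec.dim_subset differential_tangent_space assms)
  finally show ?thesis .
qed

lemma zariski_closed_vimage:
  assumes "zariski_closed Z" "zariski_closed X" "polymap H"
  shows "zariski_closed {z \<in> X. H z \<in> Z}"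
proof -
  obtain A B where A: "Z = {z. \<forall>f\<in>A. poly_eval f z = 0}" and B: "X = {z. \<forall>f\<in>B. poly_eval f z = 0}"
    using assms unfolding zariski_closed_def by blast
  have "\<forall>f. \<exists>g. (\<lambda>z. poly_eval f (H z)) = poly_eval g"
    using polyfun_polymap[OF polyfun_poly_eval assms(3)] polyfun_iff by blast
  then obtain q where "\<And>f. (\<lambda>z. poly_eval f (H z)) = poly_eval (q f)" by metis
  then have "poly_eval f (H z) = poly_eval (q f) z" for f z by metis
  then show ?thesis
    unfolding zariski_closed_def A B by (intro exI[of _ "B \<union> q ` A"]) auto
qed

lemma zariski_irreducible_image:
  assumes "zariski_irreducible Z" "polymap G"
  shows "zariski_irreducible (G ` Z)"
  unfolding zariski_irreducible_def
proof (intro conjI allI impI)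
  show "G ` Z \<noteq> {}" using assms by (auto simp: zariski_irreducible_def)
  fix A B
  assume "zariski_closed A" "zariski_closed B" "G ` Z \<subseteq> A \<union> B"
  then have "zariski_closed {z \<in> UNIV. G z \<in> A}" "zariski_closed {z \<in> UNIV. G z \<in> B}"
    "Z \<subseteq> {z \<in> UNIV. G z \<in> A} \<union> {z \<in> UNIV. G z \<in> B}"
    using zariski_closed_vimage[OF _ zariski_closed_UNIV assms(2)] by auto
  then have "Z \<subseteq> {z \<in> UNIV. G z \<in> A} \<or> Z \<subseteq> {z \<in> UNIV. G z \<in> B}"
    using assms(1) unfolding zariski_irreducible_def by blast
  then show "G ` Z \<subseteq> A \<or> G ` Z \<subseteq> B" by auto
qed

lemma local_dim_le:
  assumes "zariski_closed Y" "polymap G" "polymap H"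
    and "\<And>z. z \<in> X \<Longrightarrow> G z \<in> Y" "\<And>z. z \<in> Y \<Longrightarrow> H z \<in> X"
    and "\<And>z. z \<in> X \<Longrightarrow> H (G z) = z" "\<And>z. z \<in> Y \<Longrightarrow> G (H z) = z"
  shows "local_dim X P \<le> local_dim Y (G P)"
  unfolding local_dim_def
proof (rule SUP_subset_mono[OF _ order_refl], clarsimp)
  fix d Z
  assume Z: "\<forall>i\<le>d. zariski_closed (Z i) \<and> zariski_irreducible (Z i) \<and> P \<in> Z i \<and> Z i \<subseteq> X"
    "\<forall>i<d. Z i \<subset> Z (Suc i)"
  \<comment> \<open>Images of closed sets need not be closed; this one is, being the preimage of
    \<open>Z i\<close> under \<open>H\<close> inside the closed set \<open>Y\<close>.\<close>
  have img: "G ` Z i = {z \<in> Y. H z \<in> Z i}" if "i \<le> d" for i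
  proof -
    have "Z i \<subseteq> X" using Z that by blast
    then show ?thesis using assms(4-7) by (auto simp: image_iff) (metis subsetD)+
  qed
  have "zariski_closed (G ` Z i) \<and> zariski_irreducible (G ` Z i) \<and> G P \<in> G ` Z i \<and> G ` Z i \<subseteq> Y"
    if "i \<le> d" for i
  proof -
    have "zariski_closed (G ` Z i)"
      using that Z zariski_closed_vimage[OF _ assms(1,3)] img[OF that] by simp
    moreover have "G ` Z i \<subseteq> Y" using img[OF that] by blast
    ultimately show ?thesis
      using that Z zariski_irreducible_image[OF _ assms(2)] by simp
  qed
  moreover have "G ` Z i \<subset> G ` Z (Suc i)" if "i < d" for i
  proof -
    have "inj_on G X" using assms(6) by (metis inj_on_inverseI)
    moreover have "Z i \<subset> Z (Suc i)" "Z i \<subseteq> X" "Z (Suc i) \<subseteq> X" using Z that by auto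
    ultimately show ?thesis
      by (metis image_mono inj_on_image_eq_iff psubset_eq)
  qed
  ultimately show "\<exists>Z. (\<forall>i\<le>d. zariski_closed (Z i) \<and> zariski_irreducible (Z i) \<and> G P \<in> Z i \<and> Z i \<subseteq> Y) \<and>
      (\<forall>i<d. Z i \<subset> Z (Suc i))"
    by (intro exI[of _ "\<lambda>i. G ` Z i"]) auto
qed

text \<open>Both directions of the isomorphism extend to polynomial maps of the whole space, to
  which differentials and preimages apply; they are asked to be inverse to each other on
  \<open>X\<close> alone.\<close>

lemma mem_Aut_iff:
  "g \<in> carrier (Aut X) \<longleftrightarrow> g \<in> extensional X \<and> (\<exists>G H. polymap G \<and> polymap H \<and>
    (\<forall>z\<in>X. g z = G z \<and> G z \<in> X \<and> H z \<in> X \<and> H (G z) = z \<and> G (H z) = z))"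
  (is "?L \<longleftrightarrow> ?R")
proof
  assume ?L
  then have g: "g \<in> extensional X" "bij_betw g X X" "regular_map X X g" "regular_map X X (inv_into X g)"
    by (auto simp: Aut_def Bij_def)
  then obtain G H where GH: "polymap G" "polymap H" "\<forall>z\<in>X. g z = G z" "\<forall>z\<in>X. inv_into X g z = H z"
    unfolding regular_map_iff by blast
  have "g z \<in> X" "inv_into X g z \<in> X" "inv_into X g (g z) = z" "g (inv_into X g z) = z"
    if "z \<in> X" for z
    using g(2) that by (auto simp: bij_betwE bij_betw_inv_into_left bij_betw_inv_into_right
        bij_betw_def inv_into_into)
  then show ?R using g(1) GH by metis
next
  assume ?R
  then obtain G H where g: "g \<in> extensional X" "polymap G" "polymap H"
    and GH: "\<And>z. z \<in> X \<Longrightarrow> g z = G z \<and> G z \<in> X \<and> H z \<in> X \<and> H (G z) = z \<and> G (H z) = z"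
    by blast
  have bij: "bij_betw g X X"
    by (rule bij_betw_byWitness[of _ H]) (use GH in auto)
  have "inv_into X g z = H z" if "z \<in> X" for z
    using GH that bij by (metis bij_betw_inv_into_left)
  then show ?L
    using g bij GH by (auto simp: Aut_def Bij_def regular_map_iff)
qed

section \<open>The automorphism group and its action on the regular points\<close>

lemma subgroup_Aut: "subgroup (carrier (Aut X)) (BijGroup X)"
proof (rule group.subgroupI[OF group_BijGroup])
  show "carrier (Aut X) \<subseteq> carrier (BijGroup X)"
    by (auto simp: Aut_def BijGroup_def)
  have "(\<lambda>z\<in>X. z) \<in> carrier (Aut X)"
    unfolding mem_Aut_iff by (auto intro!: exI[of _ "\<lambda>z. z"] simp: polymap_def)
  then show "carrier (Aut X) \<noteq> {}" by blast
next
  fix g assume g: "g \<in> carrier (Aut X)"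
  then have Bij: "g \<in> Bij X" by (auto simp: Aut_def)
  obtain G H where GH: "polymap G" "polymap H"
    "\<And>z. z \<in> X \<Longrightarrow> g z = G z \<and> G z \<in> X \<and> H z \<in> X \<and> H (G z) = z \<and> G (H z) = z"
    using g unfolding mem_Aut_iff by blast
  have "inv_into X g z = H z" if "z \<in> X" for z
    using GH that Bij unfolding Bij_def by (metis (no_types, lifting) IntD2 bij_betw_inv_into_left mem_Collect_eq)
  then have "restrict (inv_into X g) X \<in> carrier (Aut X)"
    unfolding mem_Aut_iff using GH by (intro conjI exI[of _ H] exI[of _ G]) auto
  moreover have "inv\<^bsub>BijGroup X\<^esub> g = restrict (inv_into X g) X"
    using Bij by (simp add: inv_BijGroup)
  ultimately show "inv\<^bsub>BijGroup X\<^esub> g \<in> carrier (Aut X)" by simp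
next
  fix g g' assume g: "g \<in> carrier (Aut X)" "g' \<in> carrier (Aut X)"
  then have Bij: "g \<in> Bij X" "g' \<in> Bij X" by (auto simp: Aut_def)
  obtain G H where GH: "polymap G" "polymap H"
    "\<And>z. z \<in> X \<Longrightarrow> g z = G z \<and> G z \<in> X \<and> H z \<in> X \<and> H (G z) = z \<and> G (H z) = z"
    using g(1) unfolding mem_Aut_iff by blast
  obtain G' H' where GH': "polymap G'" "polymap H'"
    "\<And>z. z \<in> X \<Longrightarrow> g' z = G' z \<and> G' z \<in> X \<and> H' z \<in> X \<and> H' (G' z) = z \<and> G' (H' z) = z"
    using g(2) unfolding mem_Aut_iff by blast
  have "compose X g g' \<in> carrier (Aut X)"
    unfolding mem_Aut_iff
  proof (intro conjI exI)
    show "polymap (\<lambda>z. G (G' z))" "polymap (\<lambda>z. H' (H z))"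
      using GH GH' by (auto intro: polymap_comp)
  qed (use GH GH' in \<open>auto simp: compose_def\<close>)
  then show "g \<otimes>\<^bsub>BijGroup X\<^esub> g' \<in> carrier (Aut X)"
    using Bij by (simp add: BijGroup_def)
qed

lemma Aut_eq: "Aut X = (BijGroup X)\<lparr>carrier := carrier (Aut X)\<rparr>"
  by (simp add: Aut_def)

lemma group_Aut: "group (Aut X)"
  using subgroup.subgroup_is_group[OF subgroup_Aut group_BijGroup] Aut_eq by metis

lemma mult_Aut: "g \<in> carrier (Aut X) \<Longrightarrow> g' \<in> carrier (Aut X) \<Longrightarrow> g \<otimes>\<^bsub>Aut X\<^esub> g' = compose X g g'"
  by (auto simp: Aut_def BijGroup_def)

text \<open>Tangent dimension and local dimension are both invariants: each is compared along
  \<open>G\<close> from \<open>z\<close> and along \<open>H\<close> back from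
  \<open>G z\<close>.\<close>

lemma Aut_preserves_regular:
  assumes "zariski_closed X" "g \<in> carrier (Aut X)"
  shows "bij_betw g (X - sing X) (X - sing X)"
proof -
  obtain G H where GH: "polymap G" "polymap H"
    "\<And>z. z \<in> X \<Longrightarrow> g z = G z \<and> G z \<in> X \<and> H z \<in> X \<and> H (G z) = z \<and> G (H z) = z"
    using assms(2) unfolding mem_Aut_iff by blast
  have eq: "G z \<in> sing X \<longleftrightarrow> z \<in> sing X" if "z \<in> X" for z
  proof -
    have "vec.dim (tangent_space X z) \<le> vec.dim (tangent_space X (G z))"
      "vec.dim (tangent_space X (G z)) \<le> vec.dim (tangent_space X (H (G z)))"
      using GH that dim_tangent_space_le[of G H X X z] dim_tangent_space_le[of H G X X "G z"]
      by simp_all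
    moreover have "local_dim X z \<le> local_dim X (G z)" "local_dim X (G z) \<le> local_dim X (H (G z))"
      using GH assms(1) local_dim_le[of X G H X z] local_dim_le[of X H G X "G z"]
      by simp_all
    ultimately show ?thesis using GH(3)[OF that] by (simp add: sing_def that)
  qed
  have "H z \<in> sing X \<longleftrightarrow> z \<in> sing X" if "z \<in> X" for z
    using eq[of "H z"] GH(3)[OF that] by simp
  then show ?thesis
    using eq GH by (intro bij_betw_byWitness[of _ H]) auto
qed

lemma group_action_Aut:
  assumes "zariski_closed X"
  shows "group_action (Aut X) (X - sing X) (\<lambda>g. restrict g (X - sing X))"
proof -
  let ?Y = "X - sing X"
  have Bij: "restrict g ?Y \<in> Bij ?Y" if "g \<in> carrier (Aut X)" for g
    using Aut_preserves_regular[OF assms that] by (simp add: Bij_def)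
  have "(\<lambda>g. restrict g ?Y) \<in> hom (Aut X) (BijGroup ?Y)"
  proof (rule homI)
    fix g assume "g \<in> carrier (Aut X)"
    then show "restrict g ?Y \<in> carrier (BijGroup ?Y)" using Bij by (simp add: BijGroup_def)
  next
    fix g g' assume g: "g \<in> carrier (Aut X)" "g' \<in> carrier (Aut X)"
    have "restrict (compose X g g') ?Y = compose ?Y (restrict g ?Y) (restrict g' ?Y)"
      using Aut_preserves_regular[OF assms g(2)]
      by (auto simp: compose_def restrict_def fun_eq_iff dest: bij_betwE)
    then show "restrict (g \<otimes>\<^bsub>Aut X\<^esub> g') ?Y = restrict g ?Y \<otimes>\<^bsub>BijGroup ?Y\<^esub> restrict g' ?Y"
      using g Bij by (simp add: mult_Aut BijGroup_def)
  qed
  then show ?thesis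
    unfolding group_action_def group_hom_def group_hom_axioms_def
    by (simp add: group_Aut group_BijGroup)
qed

section \<open>Singular points of the hypersurface\<close>

definition xpart :: "complex ^ ('k::finite) coord \<Rightarrow> complex ^ 'k"
  where "xpart z = (\<chi> i. z $ Coord_x i)"

definition mkpt :: "complex ^ ('k::finite) \<Rightarrow> complex \<Rightarrow> complex \<Rightarrow> complex ^ 'k coord"
  where "mkpt x u v = (\<chi> c. case c of Coord_x i \<Rightarrow> x $ i | Coord_u \<Rightarrow> u | Coord_v \<Rightarrow> v)"

definition uvp :: "('k::finite) cpoly \<Rightarrow> complex ^ 'k coord \<Rightarrow> complex"
  where "uvp p z = z $ Coord_u * z $ Coord_v - poly_eval p (xpart z)"

lemma xpart_nth [simp]: "xpart z $ i = z $ Coord_x i"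
  by (simp add: xpart_def)

lemma mkpt_simps [simp]:
  "mkpt x u v $ Coord_x i = x $ i" "mkpt x u v $ Coord_u = u" "mkpt x u v $ Coord_v = v"
  "xpart (mkpt x u v) = x"
  by (simp_all add: mkpt_def xpart_def)

lemma xpart_add [simp]: "xpart (z + w) = xpart z + xpart w"
  and xpart_scale [simp]: "xpart (c *s z) = c *s xpart z"
  by (simp_all add: vec_eq_iff)

lemma coord_vec_eqI:
  assumes "xpart z = xpart z'" "z $ Coord_u = z' $ Coord_u" "z $ Coord_v = z' $ Coord_v"
  shows "z = z'"
proof (rule vec_eq_iff[THEN iffD2], rule allI)
  fix c show "z $ c = z' $ c"
    using assms by (cases c) (metis xpart_nth)+
qed

lemma polyfun_xpart: "polyfun f \<Longrightarrow> polyfun (\<lambda>z. f (xpart z))"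
  by (rule polyfun_compose_vec) auto

lemma polymap_mkpt:
  assumes "\<And>i. polyfun (\<lambda>z. f z $ i)" "polyfun g" "polyfun h"
  shows "polymap (\<lambda>z. mkpt (f z) (g z) (h z))"
  unfolding polymap_def
proof
  fix c show "polyfun (\<lambda>z. mkpt (f z) (g z) (h z) $ c)"
    using assms by (cases c) auto
qed

lemma polyfun_uvp: "polyfun (uvp p)"
proof -
  have "polyfun (\<lambda>z. uvp p z)"
    unfolding uvp_def by (intro polyfun_diff polyfun.mult polyfun_xpart) auto
  then show ?thesis by simp
qed

lemma uv_hypersurface_eq: "uv_hypersurface p = {z. uvp p z = 0}"
  by (simp add: uv_hypersurface_def uvp_def xpart_def)

lemma dirderiv_uvp:
  "dirderiv (uvp p) z w = w $ Coord_u * z $ Coord_v + w $ Coord_v * z $ Coord_u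
    - dirderiv (poly_eval p) (xpart z) (xpart w)"
proof -
  have p: "((\<lambda>t. poly_eval p (xpart z + t *s xpart w)) has_field_derivative
      dirderiv (poly_eval p) (xpart z) (xpart w)) (at 0)"
    by (rule dirderiv_line) simp
  have "((\<lambda>t. uvp p (z + t *s w)) has_field_derivative w $ Coord_u * z $ Coord_v + w $ Coord_v * z $ Coord_u
      - dirderiv (poly_eval p) (xpart z) (xpart w)) (at 0)"
    unfolding uvp_def xpart_add xpart_scale
    by (rule DERIV_diff[OF _ p]) (auto intro!: derivative_eq_intros)
  then show ?thesis
    unfolding dirderiv_def[of "uvp p"] by (rule DERIV_imp_deriv)
qed

lemma dirderiv_zero_if_line_in_zero_set:
  assumes "\<And>t. f (z + t *s w) = 0"
  shows "dirderiv f z w = 0"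
  unfolding dirderiv_def using assms by simp

text \<open>At a critical point of \<open>uv - p\<close> we have \<open>p(x + t w) = t\<^sup>2 r(t)\<close>, so \<open>(x + t w, t, t r(t))\<close> is a
  curve in \<open>X\<close>; with the lines \<open>(x, t, 0)\<close> and \<open>(x, 0, t)\<close> these make the tangent space all of
  \<open>\<complex>\<^bsup>k+2\<^esup>\<close>.\<close>

lemma tangent_space_at_critical_point:
  assumes "uvp p z = 0" "\<And>w. dirderiv (uvp p) z w = 0"
  shows "tangent_space {z. uvp p z = 0} z = UNIV"
proof -
  let ?eu = "mkpt 0 1 0" and ?ev = "mkpt 0 0 1" and ?x = "xpart z"
  have dp0: "dirderiv (poly_eval p) ?x 0 = 0"
    using dirderiv_scale[of "poly_eval p" ?x 0 0] by simp
  have v: "z $ Coord_v = 0" and u: "z $ Coord_u = 0"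
    using assms(2)[of ?eu] assms(2)[of ?ev] dp0 unfolding dirderiv_uvp by simp_all
  have dp: "dirderiv (poly_eval p) ?x w = 0" for w
    using assms(2)[of "mkpt w 0 0"] by (simp add: dirderiv_uvp)
  have px: "poly_eval p ?x = 0" using assms(1) u by (simp add: uvp_def)
  have "dirderiv f z y = 0" if f: "polyfun f" "\<forall>z\<in>{z. uvp p z = 0}. f z = 0" for f y
  proof -
    have eu: "dirderiv f z ?eu = 0" and ev: "dirderiv f z ?ev = 0"
      using f u v px by (auto intro!: dirderiv_zero_if_line_in_zero_set simp: uvp_def)
    define w where "w = xpart y"
    obtain q where q: "\<And>t. poly_eval p (?x + t *s w) = poly q t"
      using polyfun_along_line[of "poly_eval p" ?x w] by auto
    obtain c q1 where q1: "q = pCons c q1" by (cases q)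
    have c: "c = 0" using q[of 0] px q1 by simp
    have "((\<lambda>t. poly q t) has_field_derivative 0) (at 0)"
      using dirderiv_line[of "poly_eval p" ?x w] dp q by simp
    moreover have "((\<lambda>t. poly q t) has_field_derivative poly q1 0) (at 0)"
      using poly_DERIV[of q 0] q1 c by (simp add: pderiv_pCons)
    ultimately have "poly q1 0 = 0" using DERIV_unique by metis
    then obtain r where r: "q1 = pCons 0 r" by (cases q1) auto
    define \<gamma> where "\<gamma> t = mkpt (?x + t *s w) t (t * poly r t)" for t
    have "f (\<gamma> t) = 0" for t
      using f(2) q[of t] q1 c r by (simp add: \<gamma>_def uvp_def)
    moreover have "((\<lambda>t. f (\<gamma> t)) has_field_derivative dirderiv f z (mkpt w 1 (poly r 0))) (at 0)"
    proof (rule polyfun_chain_rule[OF f(1)])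
      show "\<gamma> 0 = z" using u v by (auto intro: coord_vec_eqI simp: \<gamma>_def)
      fix i show "((\<lambda>t. \<gamma> t $ i) has_field_derivative mkpt w 1 (poly r 0) $ i) (at 0)"
        by (cases i) (auto simp: \<gamma>_def intro!: derivative_eq_intros)
    qed
    ultimately have *: "dirderiv f z (mkpt w 1 (poly r 0)) = 0"
      using DERIV_unique[OF _ DERIV_const[of 0]] by simp
    have "y = mkpt w 1 (poly r 0) + ((y $ Coord_u - 1) *s ?eu + (y $ Coord_v - poly r 0) *s ?ev)"
      by (rule coord_vec_eqI) (auto simp: w_def vec_eq_iff)
    then have "dirderiv f z y = dirderiv f z (mkpt w 1 (poly r 0) +
        ((y $ Coord_u - 1) *s ?eu + (y $ Coord_v - poly r 0) *s ?ev))" by simp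
    then show ?thesis
      by (simp only: dirderiv_add[OF f(1)] dirderiv_scale[OF f(1)] * eu ev) simp
  qed
  then show ?thesis by (auto simp: mem_tangent_space_iff)
qed

lemma critical_point_singular:
  assumes "uvp p z = 0" "\<And>w. dirderiv (uvp p) z w = 0"
  shows "z \<in> sing {z. uvp p z = 0}"
proof -
  \<comment> \<open>\<open>uvp p\<close> takes the values -p(0) and 1 - p(0) at these points, so its
    zero set is not the whole space.\<close>
  have "mkpt 0 0 0 \<notin> {z. uvp p z = 0} \<or> mkpt 0 1 1 \<notin> {z. uvp p z = 0}"
    by (auto simp: uvp_def)
  then have "{z. uvp p z = 0} \<noteq> UNIV" by blast
  from local_dim_less[OF this, of z] show ?thesis
    using tangent_space_at_critical_point[OF assms] assms(1) by (simp add: sing_def vec_dim_card del: vec.dim_UNIV)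
qed

section \<open>Ambient automorphisms\<close>

text \<open>Preserving the function \<open>uvp p\<close>, not just its zero set, passes to inverses
  and carries its derivatives along without a factor.\<close>

definition ambient_aut :: "('k::finite) cpoly \<Rightarrow> (complex ^ 'k coord \<Rightarrow> complex ^ 'k coord) \<Rightarrow> bool"
  where "ambient_aut p \<sigma> \<longleftrightarrow> (\<exists>\<tau>. polymap \<sigma> \<and> polymap \<tau> \<and>
    (\<forall>z. \<sigma> (\<tau> z) = z \<and> \<tau> (\<sigma> z) = z \<and> uvp p (\<sigma> z) = uvp p z))"

lemma ambient_aut_comp:
  assumes "ambient_aut p \<sigma>" "ambient_aut p \<sigma>'"
  shows "ambient_aut p (\<lambda>z. \<sigma> (\<sigma>' z))"
proof -
  obtain \<tau> \<tau>' where "polymap \<sigma>" "polymap \<tau>" "polymap \<sigma>'" "polymap \<tau>'"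
    and *: "\<And>z. \<sigma> (\<tau> z) = z \<and> \<tau> (\<sigma> z) = z \<and> uvp p (\<sigma> z) = uvp p z"
    "\<And>z. \<sigma>' (\<tau>' z) = z \<and> \<tau>' (\<sigma>' z) = z \<and> uvp p (\<sigma>' z) = uvp p z"
    using assms unfolding ambient_aut_def by blast
  then have "polymap (\<lambda>z. \<sigma> (\<sigma>' z))" "polymap (\<lambda>z. \<tau>' (\<tau> z))"
    by (auto intro: polymap_comp)
  then show ?thesis
    unfolding ambient_aut_def by (intro exI[of _ "\<lambda>z. \<tau>' (\<tau> z)"]) (simp add: *)
qed

lemma ambient_aut_inverse:
  assumes "ambient_aut p \<sigma>"
  obtains \<tau> where "ambient_aut p \<tau>" "\<And>z. \<sigma> (\<tau> z) = z" "\<And>z. \<tau> (\<sigma> z) = z"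
proof -
  obtain \<tau> where "polymap \<sigma>" "polymap \<tau>"
    and *: "\<And>z. \<sigma> (\<tau> z) = z \<and> \<tau> (\<sigma> z) = z \<and> uvp p (\<sigma> z) = uvp p z"
    using assms unfolding ambient_aut_def by blast
  moreover have "uvp p (\<tau> z) = uvp p z" for z using * by metis
  ultimately have "ambient_aut p \<tau>" unfolding ambient_aut_def by blast
  with that * show ?thesis by blast
qed

lemma ambient_aut_uvp: "ambient_aut p \<sigma> \<Longrightarrow> uvp p (\<sigma> z) = uvp p z"
  by (auto simp: ambient_aut_def)

lemma ambient_aut_inj: "ambient_aut p \<sigma> \<Longrightarrow> \<sigma> z = \<sigma> z' \<longleftrightarrow> z = z'"
  unfolding ambient_aut_def by metis

lemma ambient_aut_id: "ambient_aut p (\<lambda>z. z)"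
  by (auto simp: ambient_aut_def polymap_def)

text \<open>The equation is symmetric in u and v, so conjugation by this involution gives shears
  preserving v; only those preserving u are constructed.\<close>

definition swap :: "complex ^ ('k::finite) coord \<Rightarrow> complex ^ 'k coord"
  where "swap z = mkpt (xpart z) (z $ Coord_v) (z $ Coord_u)"

lemma swap_simps [simp]:
  "xpart (swap z) = xpart z" "swap z $ Coord_u = z $ Coord_v" "swap z $ Coord_v = z $ Coord_u"
  by (simp_all add: swap_def)

lemma swap_swap [simp]: "swap (swap z) = z"
  by (rule coord_vec_eqI) auto

lemma uvp_swap [simp]: "uvp p (swap z) = uvp p z"
  by (simp add: uvp_def mult.commute)

lemma ambient_aut_swap: "ambient_aut p swap"
proof -
  have "polymap (\<lambda>z. swap z)" unfolding swap_def by (rule polymap_mkpt) auto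
  then show ?thesis by (auto simp: ambient_aut_def)
qed

lemma ambient_aut_restrict:
  assumes "ambient_aut p \<sigma>"
  shows "restrict \<sigma> {z. uvp p z = 0} \<in> carrier (Aut {z. uvp p z = 0})"
proof -
  obtain \<tau> where "polymap \<sigma>" "polymap \<tau>"
    and *: "\<And>z. \<sigma> (\<tau> z) = z \<and> \<tau> (\<sigma> z) = z \<and> uvp p (\<sigma> z) = uvp p z"
    using assms unfolding ambient_aut_def by blast
  moreover have "uvp p (\<tau> z) = uvp p z" for z using * by metis
  ultimately show ?thesis
    unfolding mem_Aut_iff by (intro conjI exI[of _ \<sigma>] exI[of _ \<tau>]) auto
qed

lemma ambient_aut_noncritical:
  assumes "ambient_aut p \<sigma>" "dirderiv (uvp p) z w \<noteq> 0"
  shows "dirderiv (uvp p) (\<sigma> z) (differential \<sigma> z w) \<noteq> 0"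
proof -
  have "polymap \<sigma>" using assms(1) by (auto simp: ambient_aut_def)
  then have "dirderiv (\<lambda>z. uvp p (\<sigma> z)) z w = dirderiv (uvp p) (\<sigma> z) (differential \<sigma> z w)"
    by (rule dirderiv_compose[OF polyfun_uvp])
  then show ?thesis using assms by (simp add: ambient_aut_uvp)
qed

text \<open>Divisibility of differences by \<open>S\<close> passes to products as in the product
  rule. The quotient is polynomial, so it makes sense where \<open>S\<close> vanishes; with
  \<open>S\<close> = u it supplies (p(x + u h w) - p(x)) / u.\<close>

lemma polyfun_divided_difference:
  assumes "polyfun f" "\<And>j. polyfun (A j)" "\<And>j. polyfun (B j)" "polyfun S"
  shows "\<exists>D. polyfun D \<and> (\<forall>z. S z * D z = f (\<chi> j. A j z + S z * B j z) - f (\<chi> j. A j z))"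
  using assms(1)
proof induction
  case (const c)
  show ?case by (rule exI[of _ "\<lambda>_. 0"]) auto
next
  case (coord i)
  show ?case by (rule exI[of _ "B i"]) (simp add: assms)
next
  case (add f g)
  then obtain D E where "polyfun D" "\<forall>z. S z * D z = f (\<chi> j. A j z + S z * B j z) - f (\<chi> j. A j z)"
    "polyfun E" "\<forall>z. S z * E z = g (\<chi> j. A j z + S z * B j z) - g (\<chi> j. A j z)" by blast
  then show ?case
    by (intro exI[of _ "\<lambda>z. D z + E z"]) (auto simp: algebra_simps)
next
  case (mult f g)
  then obtain D E where D: "polyfun D" "\<And>z. S z * D z = f (\<chi> j. A j z + S z * B j z) - f (\<chi> j. A j z)"
    and E: "polyfun E" "\<And>z. S z * E z = g (\<chi> j. A j z + S z * B j z) - g (\<chi> j. A j z)" by blast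
  let ?D = "\<lambda>z. D z * g (\<chi> j. A j z) + f (\<chi> j. A j z + S z * B j z) * E z"
  have "polyfun (\<lambda>z. g (\<chi> j. A j z))" "polyfun (\<lambda>z. f (\<chi> j. A j z + S z * B j z))"
    using mult.hyps assms by (intro polyfun_compose polyfun.add polyfun.mult; simp)+
  then have "polyfun ?D" using D E by auto
  moreover have "S z * ?D z = f (\<chi> j. A j z + S z * B j z) * g (\<chi> j. A j z + S z * B j z)
      - f (\<chi> j. A j z) * g (\<chi> j. A j z)" for z
  proof -
    have "S z * ?D z = (S z * D z) * g (\<chi> j. A j z) + f (\<chi> j. A j z + S z * B j z) * (S z * E z)"
      by (simp add: algebra_simps)
    then show ?thesis unfolding D E by (simp add: algebra_simps)
  qed
  ultimately show ?case by (intro exI[of _ ?D]) auto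
qed

section \<open>Shears preserving u\<close>

definition shear_map :: "complex ^ ('k::finite) \<Rightarrow> (complex ^ 'k coord \<Rightarrow> complex) \<Rightarrow>
    (complex ^ 'k coord \<Rightarrow> complex) \<Rightarrow> complex ^ 'k coord \<Rightarrow> complex ^ 'k coord"
  where "shear_map w h D z = mkpt (xpart z + (z $ Coord_u * h z) *s w) (z $ Coord_u) (z $ Coord_v + D z)"

text \<open>Written without division, since the quotient by u is needed at points with u = 0
  too.\<close>

definition shear_quotient :: "('k::finite) cpoly \<Rightarrow> complex ^ 'k \<Rightarrow> (complex ^ 'k coord \<Rightarrow> complex) \<Rightarrow>
    (complex ^ 'k coord \<Rightarrow> complex) \<Rightarrow> bool"
  where "shear_quotient p w h D \<longleftrightarrow> polyfun D \<and> (\<forall>z. z $ Coord_u * D z =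
    poly_eval p (xpart z + (z $ Coord_u * h z) *s w) - poly_eval p (xpart z))"

definition shear_invariant :: "complex ^ ('k::finite) \<Rightarrow> (complex ^ 'k coord \<Rightarrow> complex) \<Rightarrow> bool"
  where "shear_invariant w h \<longleftrightarrow> (\<forall>z z' t. z' $ Coord_u = z $ Coord_u \<longrightarrow> xpart z' = xpart z + t *s w \<longrightarrow> h z' = h z)"

lemma shear_quotient_exists:
  assumes "polyfun h"
  shows "\<exists>D. shear_quotient p w h D"
proof -
  have "\<exists>D. polyfun D \<and> (\<forall>z. z $ Coord_u * D z =
      poly_eval p (\<chi> j. z $ Coord_x j + z $ Coord_u * (h z * w $ j)) - poly_eval p (\<chi> j. z $ Coord_x j))"
    using assms by (intro polyfun_divided_difference) auto
  moreover have "(\<chi> j. z $ Coord_x j + z $ Coord_u * (h z * w $ j)) = xpart z + (z $ Coord_u * h z) *s w"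
    "(\<chi> j. z $ Coord_x j) = xpart z" for z
    by (simp_all add: vec_eq_iff mult.assoc)
  ultimately show ?thesis by (simp add: shear_quotient_def)
qed

lemma polymap_shear_map:
  assumes "polyfun h" "shear_quotient p w h D"
  shows "polymap (shear_map w h D)"
proof -
  have "polymap (\<lambda>z. shear_map w h D z)"
    unfolding shear_map_def using assms
    by (intro polymap_mkpt; simp add: shear_quotient_def mult.assoc; intro polyfun.add polyfun.mult; simp)
  then show ?thesis by simp
qed

lemma uvp_shear_map:
  assumes "shear_quotient p w h D"
  shows "uvp p (shear_map w h D z) = uvp p z"
  using assms by (simp add: shear_quotient_def shear_map_def uvp_def algebra_simps)

text \<open>The x-parts cancel because \<open>h\<close> has the same value before and after. The sum
  of the two shifts of v is a polynomial function that vanishes after multiplication by u, hence is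
  zero.\<close>

lemma shear_map_inverse:
  assumes "shear_invariant w h" "polyfun h" "shear_quotient p w h D" "shear_quotient p w (\<lambda>z. - h z) D'"
  shows "shear_map w (\<lambda>z. - h z) D' (shear_map w h D z) = z"
proof -
  let ?s = "shear_map w h D"
  have h: "h (?s z) = h z" for z
    using assms(1)[unfolded shear_invariant_def, rule_format, of "?s z" z "z $ Coord_u * h z"]
    by (simp add: shear_map_def)
  have x: "xpart (?s z) + (?s z $ Coord_u * - h (?s z)) *s w = xpart z" for z
    unfolding h by (simp add: shear_map_def vec_eq_iff)
  have "z $ Coord_u * (D z + D' (?s z)) = 0" for z
  proof -
    have "z $ Coord_u * D' (?s z) = poly_eval p (xpart z) - poly_eval p (xpart (?s z))"
    proof -
      have "?s z $ Coord_u * D' (?s z)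
          = poly_eval p (xpart (?s z) + (?s z $ Coord_u * - h (?s z)) *s w) - poly_eval p (xpart (?s z))"
        using assms(4) unfolding shear_quotient_def by blast
      then show ?thesis unfolding x by (simp add: shear_map_def)
    qed
    moreover have "z $ Coord_u * D z = poly_eval p (xpart (?s z)) - poly_eval p (xpart z)"
      using assms(3) by (simp add: shear_quotient_def shear_map_def)
    ultimately show ?thesis by (simp add: distrib_left)
  qed
  moreover have "polyfun (\<lambda>z. D z + D' (?s z))"
    using assms polymap_shear_map[OF assms(2,3)]
    by (auto simp: shear_quotient_def intro: polyfun_polymap)
  moreover have "mkpt 0 1 0 $ Coord_u \<noteq> 0" by simp
  ultimately have D: "D z + D' (?s z) = 0" for z
    using polyfun_mult_eq_0[of "\<lambda>z. z $ Coord_u" "\<lambda>z. D z + D' (?s z)"] by blast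
  show ?thesis
    using x[of z] D[of z]
    by (intro coord_vec_eqI) (simp_all add: shear_map_def[of w "\<lambda>z. - h z"], simp_all add: shear_map_def add.assoc)
qed

text \<open>At u = 0 the defining relation only says 0 = 0; its derivative in the direction of u
  gives the value of \<open>D\<close>.\<close>

lemma shear_quotient_on_u_0:
  assumes "shear_quotient p w h D" "polyfun h" "z $ Coord_u = 0"
  shows "D z = h z * dirderiv (poly_eval p) (xpart z) w"
proof -
  have D: "polyfun D" "\<And>z. z $ Coord_u * D z =
    poly_eval p (xpart z + (z $ Coord_u * h z) *s w) - poly_eval p (xpart z)"
    using assms by (auto simp: shear_quotient_def)
  define \<gamma> where "\<gamma> s = mkpt (xpart z) s (z $ Coord_v)" for s
  have \<gamma>0: "\<gamma> 0 = z" using assms(3) by (auto simp: \<gamma>_def intro: coord_vec_eqI)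
  have \<gamma>': "((\<lambda>s. \<gamma> s $ i) has_field_derivative mkpt 0 1 0 $ i) (at 0)" for i
    by (cases i) (auto simp: \<gamma>_def intro!: derivative_eq_intros)
  note * = polyfun_chain_rule[OF _ \<gamma>0 \<gamma>']
  have "((\<lambda>s. s * D (\<gamma> s)) has_field_derivative D z) (at 0)"
    using DERIV_mult[OF DERIV_ident *[OF D(1)]] by (simp add: \<gamma>0)
  moreover have "((\<lambda>s. poly_eval p (xpart z + (s * h (\<gamma> s)) *s w) - poly_eval p (xpart z))
      has_field_derivative dirderiv (poly_eval p) (xpart z) (h z *s w) - 0) (at 0)"
  proof (intro DERIV_diff polyfun_chain_rule)
    have sh: "((\<lambda>s. s * h (\<gamma> s)) has_field_derivative h z) (at 0)"
      using DERIV_mult[OF DERIV_ident *[OF assms(2)]] by (simp add: \<gamma>0)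
    show "((\<lambda>s. (xpart z + (s * h (\<gamma> s)) *s w) $ i) has_field_derivative (h z *s w) $ i) (at 0)" for i
      using DERIV_add[OF DERIV_const[of "z $ Coord_x i"] DERIV_cmult_right[OF sh, of "w $ i"]] by simp
  qed auto
  moreover have "(\<lambda>s. s * D (\<gamma> s)) = (\<lambda>s. poly_eval p (xpart z + (s * h (\<gamma> s)) *s w) - poly_eval p (xpart z))"
  proof
    fix s show "s * D (\<gamma> s) = poly_eval p (xpart z + (s * h (\<gamma> s)) *s w) - poly_eval p (xpart z)"
      using D(2)[of "\<gamma> s"] by (simp add: \<gamma>_def)
  qed
  ultimately have "D z = dirderiv (poly_eval p) (xpart z) (h z *s w) - 0"
    by (simp only: DERIV_unique)
  then show ?thesis by (simp add: dirderiv_scale)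
qed

text \<open>The new v-coordinate is described on u = 0 only: elsewhere on X the equation uv = p(x)
  determines it from x and u.\<close>

lemma ambient_shear:
  assumes "polyfun h" "shear_invariant w h"
  obtains \<sigma> where "ambient_aut p \<sigma>" "\<And>z. xpart (\<sigma> z) = xpart z + (z $ Coord_u * h z) *s w"
    "\<And>z. \<sigma> z $ Coord_u = z $ Coord_u"
    "\<And>z. z $ Coord_u = 0 \<Longrightarrow> \<sigma> z $ Coord_v = z $ Coord_v + h z * dirderiv (poly_eval p) (xpart z) w"
proof -
  have h': "polyfun (\<lambda>z. - h z)" "shear_invariant w (\<lambda>z. - h z)"
  proof -
    show "polyfun (\<lambda>z. - h z)"
      using polyfun_diff[OF polyfun.const[of 0] assms(1)] by simp
    show "shear_invariant w (\<lambda>z. - h z)"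
      using assms(2) unfolding shear_invariant_def neg_equal_iff_equal .
  qed
  obtain D D' where D: "shear_quotient p w h D" "shear_quotient p w (\<lambda>z. - h z) D'"
    using shear_quotient_exists assms(1) h' by meson
  have "shear_map w h D (shear_map w (\<lambda>z. - h z) D' z) = z" for z
    using shear_map_inverse[OF h'(2,1) D(2), of D] D(1) by simp
  then have "ambient_aut p (shear_map w h D)"
    unfolding ambient_aut_def
    using polymap_shear_map[OF assms(1) D(1)] polymap_shear_map[OF h'(1) D(2)]
      shear_map_inverse[OF assms(2,1) D] uvp_shear_map[OF D(1)] by blast
  then show ?thesis
    by (rule that) (auto simp: shear_map_def shear_quotient_on_u_0[OF D(1) assms(1)])
qed

section \<open>Multiple transitivity\<close>

lemma uvp_eq_0_eqI:
  assumes "uvp p z = 0" "uvp p z' = 0" "xpart z = xpart z'" "z $ Coord_u = z' $ Coord_u" "z $ Coord_u \<noteq> 0"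
  shows "z = z'"
proof (rule coord_vec_eqI)
  have "z $ Coord_u * z $ Coord_v = z' $ Coord_u * z' $ Coord_v"
    using assms(1-3) by (simp add: uvp_def)
  then show "z $ Coord_v = z' $ Coord_v" using assms(4,5) by simp
qed (use assms in auto)

text \<open>The shear with h = 1 keeps u and, where u = 0, adds the derivative of p along
  \<open>w\<close> to v. At a noncritical point with u = v = 0 this is a nonzero linear form in
  \<open>w\<close>, so a generic \<open>w\<close> serves all of \<open>S\<close>.\<close>

lemma move_off_u_v_0:
  assumes "finite S" "\<And>z. z \<in> S \<Longrightarrow> uvp p z = 0" "\<And>z. z \<in> S \<Longrightarrow> \<exists>w. dirderiv (uvp p) z w \<noteq> 0"
  obtains \<sigma> where "ambient_aut p \<sigma>" "\<And>z. z \<in> S \<Longrightarrow> \<sigma> z $ Coord_u \<noteq> 0 \<or> \<sigma> z $ Coord_v \<noteq> 0"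
proof -
  define f where "f z w = z $ Coord_v + dirderiv (poly_eval p) (xpart z) w" for z w
  let ?S = "{z \<in> S. z $ Coord_u = 0}"
  have "polyfun (\<lambda>w. f z w)" for z
    unfolding f_def by (intro polyfun.add polyfun_dirderiv) auto
  moreover have "\<exists>w. f z w \<noteq> 0" if "z \<in> ?S" for z
  proof (cases "z $ Coord_v = 0")
    case True
    obtain w where "dirderiv (uvp p) z w \<noteq> 0" using assms(3) \<open>z \<in> ?S\<close> by blast
    then have "f z (xpart w) \<noteq> 0" using True that by (simp add: f_def dirderiv_uvp)
    then show ?thesis by blast
  next
    case False
    then have "f z 0 \<noteq> 0"
      using dirderiv_scale[of "poly_eval p" "xpart z" 0 0] by (simp add: f_def)
    then show ?thesis by blast
  qed
  ultimately obtain w where w: "\<And>z. z \<in> ?S \<Longrightarrow> f z w \<noteq> 0"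
    using polyfun_finite_common_nonzero[of ?S f] assms(1) by auto
  have "shear_invariant w (\<lambda>z. 1)" by (simp add: shear_invariant_def)
  then obtain \<sigma> where \<sigma>: "ambient_aut p \<sigma>" "\<And>z. xpart (\<sigma> z) = xpart z + (z $ Coord_u * 1) *s w"
    "\<And>z. \<sigma> z $ Coord_u = z $ Coord_u"
    "\<And>z. z $ Coord_u = 0 \<Longrightarrow> \<sigma> z $ Coord_v = z $ Coord_v + 1 * dirderiv (poly_eval p) (xpart z) w"
    using ambient_shear[OF polyfun.const[of 1], of w p] by blast
  show ?thesis
    by (rule that[OF \<sigma>(1)]) (use \<sigma> w in \<open>auto simp: f_def\<close>)
qed

lemma move_off_v_0:
  assumes "finite S" "\<And>z. z \<in> S \<Longrightarrow> uvp p z = 0" "\<And>z. z \<in> S \<Longrightarrow> z $ Coord_u \<noteq> 0 \<or> z $ Coord_v \<noteq> 0"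
    and "poly_eval p y \<noteq> 0"
  obtains \<sigma> where "ambient_aut p \<sigma>" "\<And>z. z \<in> S \<Longrightarrow> \<sigma> z $ Coord_v \<noteq> 0"
proof -
  \<comment> \<open>\<open>f z w\<close> is the new v-coordinate if u = 0, and u times it
    otherwise.\<close>
  define f where "f z w = (if z $ Coord_u = 0 then z $ Coord_v + dirderiv (poly_eval p) (xpart z) w
    else poly_eval p (xpart z + z $ Coord_u *s w))" for z w
  have "polyfun (\<lambda>w. f z w)" for z
  proof (cases "z $ Coord_u = 0")
    case True
    have "polyfun (\<lambda>w. z $ Coord_v + dirderiv (poly_eval p) (xpart z) w)" by (intro polyfun.add polyfun_dirderiv) auto
    with True show ?thesis by (simp add: f_def)
  next
    case False
    have "polyfun (\<lambda>w. poly_eval p (xpart z + z $ Coord_u *s w))" by (rule polyfun_compose_vec; simp; intro polyfun.add polyfun.mult; simp)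
    with False show ?thesis by (simp add: f_def)
  qed
  moreover have "\<exists>w. f z w \<noteq> 0" if "z \<in> S" for z
  proof (cases "z $ Coord_u = 0")
    case True
    then have "f z 0 \<noteq> 0"
      using dirderiv_scale[of "poly_eval p" "xpart z" 0 0] assms(3)[OF that] by (simp add: f_def)
    then show ?thesis by blast
  next
    case False
    \<comment> \<open>This choice of \<open>w\<close> carries the x-part of \<open>z\<close> to
      \<open>y\<close>, where p does not vanish.\<close>
    then have "xpart z + z $ Coord_u *s ((1 / z $ Coord_u) *s (y - xpart z)) = y"
      by (simp add: vec_eq_iff)
    then have "f z ((1 / z $ Coord_u) *s (y - xpart z)) \<noteq> 0"
      using False assms(4) by (simp only: f_def if_False) simp
    then show ?thesis by blast
  qed
  ultimately obtain w where w: "\<And>z. z \<in> S \<Longrightarrow> f z w \<noteq> 0"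
    using polyfun_finite_common_nonzero[of S f] assms(1) by auto
  have "shear_invariant w (\<lambda>z. 1)" by (simp add: shear_invariant_def)
  then obtain \<sigma> where \<sigma>: "ambient_aut p \<sigma>" "\<And>z. xpart (\<sigma> z) = xpart z + (z $ Coord_u * 1) *s w"
    "\<And>z. \<sigma> z $ Coord_u = z $ Coord_u"
    "\<And>z. z $ Coord_u = 0 \<Longrightarrow> \<sigma> z $ Coord_v = z $ Coord_v + 1 * dirderiv (poly_eval p) (xpart z) w"
    using ambient_shear[OF polyfun.const[of 1], of w p] by blast
  have "\<sigma> z $ Coord_v \<noteq> 0" if "z \<in> S" for z
  proof (cases "z $ Coord_u = 0")
    case True
    then show ?thesis using \<sigma>(4)[OF True] w[OF that] by (simp add: f_def)
  next
    case False
    have "uvp p (\<sigma> z) = 0" using ambient_aut_uvp[OF \<sigma>(1)] assms(2)[OF that] by simp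
    then have "z $ Coord_u * \<sigma> z $ Coord_v = f z w"
      using False by (simp add: uvp_def \<sigma>(2,3) f_def)
    then show ?thesis using w[OF that] by auto
  qed
  then show ?thesis using that \<sigma>(1) by blast
qed

text \<open>The shears preserve u, so they are used to make v nonzero at all the points; a final
  swap exchanges the two coordinates.\<close>

lemma move_off_u_0:
  assumes "finite S" "\<And>z. z \<in> S \<Longrightarrow> uvp p z = 0" "\<And>z. z \<in> S \<Longrightarrow> \<exists>w. dirderiv (uvp p) z w \<noteq> 0"
    and "poly_eval p y \<noteq> 0"
  obtains \<sigma> where "ambient_aut p \<sigma>" "\<And>z. z \<in> S \<Longrightarrow> \<sigma> z $ Coord_u \<noteq> 0"
proof -
  obtain \<sigma>1 where \<sigma>1: "ambient_aut p \<sigma>1" "\<And>z. z \<in> S \<Longrightarrow> \<sigma>1 z $ Coord_u \<noteq> 0 \<or> \<sigma>1 z $ Coord_v \<noteq> 0"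
    using move_off_u_v_0[of S p] assms by metis
  obtain \<sigma>2 where \<sigma>2: "ambient_aut p \<sigma>2" "\<And>z. z \<in> \<sigma>1 ` S \<Longrightarrow> \<sigma>2 z $ Coord_v \<noteq> 0"
    proof (rule move_off_v_0[of "\<sigma>1 ` S" p y])
    show "z \<in> \<sigma>1 ` S \<Longrightarrow> uvp p z = 0" for z
      using assms(2) by (auto simp: ambient_aut_uvp[OF \<sigma>1(1)])
    show "z \<in> \<sigma>1 ` S \<Longrightarrow> z $ Coord_u \<noteq> 0 \<or> z $ Coord_v \<noteq> 0" for z
      using \<sigma>1(2) by blast
  qed (use assms in auto)
  show ?thesis
  proof (rule that)
    show "ambient_aut p (\<lambda>z. swap (\<sigma>2 (\<sigma>1 z)))"
      by (rule ambient_aut_comp[OF ambient_aut_swap ambient_aut_comp[OF \<sigma>2(1) \<sigma>1(1)]])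
    show "swap (\<sigma>2 (\<sigma>1 z)) $ Coord_u \<noteq> 0" if "z \<in> S" for z
      using \<sigma>2(2) that by simp
  qed
qed

section \<open>Linear forms in x (a bilinear pairing, without conjugation)\<close>

definition dotp :: "complex ^ ('k::finite) \<Rightarrow> complex ^ 'k \<Rightarrow> complex"
  where "dotp l y = (\<Sum>i\<in>UNIV. l $ i * y $ i)"

lemma dotp_add: "dotp l (y + z) = dotp l y + dotp l z"
  by (simp add: dotp_def distrib_left sum.distrib)

lemma dotp_diff: "dotp l (y - z) = dotp l y - dotp l z"
  by (simp add: dotp_def right_diff_distrib sum_subtractf)

lemma dotp_scale: "dotp l (c *s y) = c * dotp l y"
  by (simp add: dotp_def sum_distrib_left mult_ac)

lemma dotp_combination: "dotp (l - c *s l') y = dotp l y - c * dotp l' y"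
  by (simp add: dotp_def left_diff_distrib sum_subtractf sum_distrib_left mult.assoc)

lemma dotp_axis_left: "dotp (axis i c) y = c * y $ i"
proof -
  have "dotp (axis i c) y = (\<Sum>j\<in>UNIV. if j = i then c * y $ j else 0)"
    unfolding dotp_def axis_def by (intro sum.cong) auto
  then show ?thesis by simp
qed

lemma polyfun_dotp: "(\<And>i. polyfun (\<lambda>z. f z $ i)) \<Longrightarrow> polyfun (\<lambda>z. dotp l (f z))"
  unfolding dotp_def by (intro polyfun_sum polyfun.mult) auto

text \<open>The condition k \<ge> 2 enters here: in dimension one only the zero form kills a nonzero
  vector.\<close>

lemma dotp_orthogonal_exists:
  fixes d :: "complex ^ ('k::finite)"
  assumes "CARD('k) \<ge> 2"
  obtains l w where "dotp l d = 0" "dotp l w \<noteq> 0"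
proof -
  obtain i :: 'k where True by simp
  have "\<exists>j. j \<noteq> i"
  proof (rule ccontr)
    assume "\<nexists>j. j \<noteq> i"
    then have "(UNIV :: 'k set) = {i}" by auto
    then have "CARD('k) = card {i}" by (rule arg_cong)
    with assms show False by simp
  qed
  then obtain j where j: "j \<noteq> i" by blast
  show ?thesis
  proof (cases "d $ i = 0")
    case True
    then show ?thesis
      using that[of "axis i 1" "axis i 1"] by (simp add: dotp_axis_left)
  next
    case False
    \<comment> \<open>The form d_j x_i - d_i x_j; the factor 1 fits it to
      \<open>dotp_combination\<close>.\<close>
    let ?l = "axis i (d $ j) - 1 *s axis j (d $ i)"
    show ?thesis
    proof (rule that)
      show "dotp ?l d = 0" by (simp only: dotp_combination dotp_axis_left) simp
      show "dotp ?l (axis j 1) \<noteq> 0"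
        using False j by (simp only: dotp_combination dotp_axis_left) (simp add: axis_def)
    qed
  qed
qed

text \<open>The hypotheses make \<open>d\<close> and \<open>w\<close> linearly independent. A
  coordinate form not killing \<open>d\<close> is corrected by a multiple of \<open>l\<close>, which
  changes its value at \<open>w\<close> but not at \<open>d\<close>.\<close>

lemma dotp_separating:
  assumes "dotp l d = 0" "dotp l w \<noteq> 0" "d \<noteq> 0"
  obtains l' where "dotp l' w = 0" "dotp l' d \<noteq> 0"
proof -
  obtain i where "d $ i \<noteq> 0" using assms(3) by (auto simp: vec_eq_iff)
  let ?e = "axis i 1"
  let ?l = "?e - (dotp ?e w / dotp l w) *s l"
  show ?thesis
  proof (rule that)
    show "dotp ?l w = 0" using assms(2) by (simp add: dotp_combination)
    show "dotp ?l d \<noteq> 0"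
      using \<open>d $ i \<noteq> 0\<close> by (simp add: dotp_combination assms(1) dotp_axis_left)
  qed
qed

text \<open>A shear along b - a whose \<open>h\<close> has one factor vanishing at each
  \<open>s\<close>: for a point in another slice a function of u, for one in the same slice a linear
  form that kills b - a, as invariance demands. By \<open>sep\<close> such a form exists that is
  nonzero at a - s, that is, \<open>s\<close> lies off the line of motion.\<close>

lemma shear_move_fixing:
  assumes fin: "finite S" and S: "\<And>s. s \<in> S \<Longrightarrow> uvp p s = 0"
    and ab: "uvp p a = 0" "uvp p b = 0" "a $ Coord_u = b $ Coord_u" "a $ Coord_u \<noteq> 0"
    and sep: "\<And>s. s \<in> S \<Longrightarrow> s $ Coord_u = a $ Coord_u \<Longrightarrow>
      \<exists>l. dotp l (xpart b - xpart a) = 0 \<and> dotp l (xpart a - xpart s) \<noteq> 0"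
  obtains \<sigma> where "ambient_aut p \<sigma>" "\<sigma> a = b" "\<And>s. s \<in> S \<Longrightarrow> \<sigma> s = s"
proof -
  let ?w = "xpart b - xpart a"
  have "\<forall>s. \<exists>l. s \<in> S \<longrightarrow> s $ Coord_u = a $ Coord_u \<longrightarrow> dotp l ?w = 0 \<and> dotp l (xpart a - xpart s) \<noteq> 0"
    using sep by blast
  from choice[OF this] obtain l where l: "\<And>s. s \<in> S \<Longrightarrow> s $ Coord_u = a $ Coord_u \<Longrightarrow>
      dotp (l s) ?w = 0 \<and> dotp (l s) (xpart a - xpart s) \<noteq> 0" by blast
  define g where "g s z = (if s $ Coord_u = a $ Coord_u then dotp (l s) (xpart z - xpart s)
    else z $ Coord_u - s $ Coord_u)" for s z
  \<comment> \<open>Normalised so that u h = 1 at \<open>a\<close>: the displacement there is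
    exactly b - a.\<close>
  define c where "c = 1 / (a $ Coord_u * (\<Prod>s\<in>S. g s a))"
  define h where "h z = c * (\<Prod>s\<in>S. g s z)" for z
  have "polyfun (\<lambda>z. g s z)" for s
  proof (cases "s $ Coord_u = a $ Coord_u")
    case True
    have "polyfun (\<lambda>z. dotp (l s) (xpart z - xpart s))" by (rule polyfun_dotp) auto
    with True show ?thesis by (simp add: g_def)
  next
    case False
    have "polyfun (\<lambda>z. z $ Coord_u - s $ Coord_u)" by auto
    with False show ?thesis by (simp add: g_def)
  qed
  then have "polyfun (\<lambda>z. h z)"
    unfolding h_def by (intro polyfun.mult polyfun_prod) auto
  moreover have "shear_invariant ?w h"
    unfolding shear_invariant_def
  proof (intro allI impI)
    fix z z' :: "complex ^ 'a coord" and t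
    assume z: "z' $ Coord_u = z $ Coord_u" "xpart z' = xpart z + t *s ?w"
    have "g s z' = g s z" if "s \<in> S" for s
    proof (cases "s $ Coord_u = a $ Coord_u")
      case True
      have "dotp (l s) (xpart z' - xpart s) = dotp (l s) (xpart z - xpart s) + t * dotp (l s) ?w"
        unfolding z(2) by (simp only: dotp_add dotp_diff dotp_scale) simp
      then show ?thesis using True l[OF that True] by (simp add: g_def)
    next
      case False
      then show ?thesis using z by (simp add: g_def)
    qed
    then show "h z' = h z" by (simp add: h_def)
  qed
  ultimately obtain \<sigma> where \<sigma>: "ambient_aut p \<sigma>" "\<And>z. xpart (\<sigma> z) = xpart z + (z $ Coord_u * h z) *s ?w"
    "\<And>z. \<sigma> z $ Coord_u = z $ Coord_u"
    "\<And>z. z $ Coord_u = 0 \<Longrightarrow> \<sigma> z $ Coord_v = z $ Coord_v + h z * dirderiv (poly_eval p) (xpart z) ?w"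
    using ambient_shear[of h ?w p] by auto
  have "g s a \<noteq> 0" if "s \<in> S" for s
    using l[OF that] by (auto simp: g_def)
  then have "(\<Prod>s\<in>S. g s a) \<noteq> 0" using fin by simp
  then have "a $ Coord_u * h a = 1" using ab(4) by (simp add: h_def c_def)
  then have "xpart (\<sigma> a) = xpart b" unfolding \<sigma>(2) by (simp add: vec_eq_iff)
  then have "\<sigma> a = b"
    using ab \<sigma>(3) by (intro uvp_eq_0_eqI[of p]) (auto simp: ambient_aut_uvp[OF \<sigma>(1)])
  moreover have "\<sigma> s = s" if "s \<in> S" for s
  proof -
    have "g s s = 0" by (simp add: g_def dotp_def)
    then have h: "h s = 0" using that fin by (auto simp: h_def)
    then have x: "xpart (\<sigma> s) = xpart s" unfolding \<sigma>(2) by simp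
    show ?thesis
    proof (cases "s $ Coord_u = 0")
      case True
      then show ?thesis using x h \<sigma>(3,4) by (intro coord_vec_eqI) auto
    next
      case False
      then show ?thesis using x \<sigma>(3) S[OF that]
        by (intro uvp_eq_0_eqI[of p]) (auto simp: ambient_aut_uvp[OF \<sigma>(1)])
    qed
  qed
  ultimately show ?thesis using that \<sigma>(1) by blast
qed

text \<open>A single shear moves \<open>a\<close> along a line in the slice \<open>u = const\<close>, which may meet \<open>S\<close>; since
  \<open>k \<ge> 2\<close>, a detour via a generic intermediate point avoids \<open>S\<close>.\<close>

lemma move_in_slice_fixing:
  fixes p :: "('k::finite) cpoly"
  assumes card: "CARD('k) \<ge> 2"
    and fin: "finite S" and S: "\<And>s. s \<in> S \<Longrightarrow> uvp p s = 0"
    and ab: "uvp p a = 0" "uvp p b = 0" "a $ Coord_u = b $ Coord_u" "a $ Coord_u \<noteq> 0"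
    and notin: "a \<notin> S" "b \<notin> S"
  obtains \<sigma> where "ambient_aut p \<sigma>" "\<sigma> a = b" "\<And>s. s \<in> S \<Longrightarrow> \<sigma> s = s"
proof -
  let ?S = "{s \<in> S. s $ Coord_u = a $ Coord_u}"
  have ne: "xpart a - xpart s \<noteq> 0" "xpart b - xpart s \<noteq> 0" if "s \<in> ?S" for s
    using that uvp_eq_0_eqI[of p a s] uvp_eq_0_eqI[of p b s] S ab notin by auto
  have "\<forall>s. \<exists>l. dotp l (xpart a - xpart s) = 0 \<and> (\<exists>w. dotp l w \<noteq> 0)"
    using dotp_orthogonal_exists[OF card] by metis
  from choice[OF this] obtain l where l: "\<And>s. dotp (l s) (xpart a - xpart s) = 0" "\<And>s. \<exists>w. dotp (l s) w \<noteq> 0"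
    by blast
  have "\<forall>s. \<exists>l. dotp l (xpart b - xpart s) = 0 \<and> (\<exists>w. dotp l w \<noteq> 0)"
    using dotp_orthogonal_exists[OF card] by metis
  from choice[OF this] obtain l' where l': "\<And>s. dotp (l' s) (xpart b - xpart s) = 0" "\<And>s. \<exists>w. dotp (l' s) w \<noteq> 0"
    by blast
  \<comment> \<open>\<open>w\<close> is the displacement from \<open>a\<close> to the intermediate
    point. If \<open>f s w\<close> is nonzero, then \<open>w\<close> is not parallel to a - s, nor
    the remaining way b - a - w to b - s, so neither leg meets \<open>s\<close>.\<close>
  define f where "f s w = dotp (l s) w * dotp (l' s) (xpart b - xpart a - w)" for s w
  have poly: "polyfun (\<lambda>w. dotp (l s) w)" "polyfun (\<lambda>w. dotp (l' s) (xpart b - xpart a - w))" for s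
    by (rule polyfun_dotp, auto)+
  have "polyfun (\<lambda>w. f s w)" for s
    unfolding f_def by (intro polyfun.mult poly)
  moreover have "\<exists>w. f s w \<noteq> 0" for s
  proof -
    obtain w1 where "dotp (l s) w1 \<noteq> 0" using l by blast
    moreover obtain w2 where "dotp (l' s) w2 \<noteq> 0" using l' by blast
    then have "dotp (l' s) (xpart b - xpart a - (xpart b - xpart a - w2)) \<noteq> 0" by simp
    ultimately show ?thesis
      unfolding f_def using polyfun_mult_nonzero[OF poly] by (metis mult_eq_0_iff)
  qed
  ultimately obtain w where "\<And>s. s \<in> ?S \<Longrightarrow> f s w \<noteq> 0"
    using polyfun_finite_common_nonzero[of ?S f] fin by auto
  then have w: "dotp (l s) w \<noteq> 0" "dotp (l' s) (xpart b - xpart a - w) \<noteq> 0" if "s \<in> ?S" for s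
    using that by (auto simp: f_def)
  define m where "m = mkpt (xpart a + w) (a $ Coord_u) (poly_eval p (xpart a + w) / a $ Coord_u)"
  have m: "uvp p m = 0" "m $ Coord_u = a $ Coord_u" "xpart m = xpart a + w"
    using ab by (auto simp: m_def uvp_def)
  obtain \<sigma>1 where \<sigma>1: "ambient_aut p \<sigma>1" "\<sigma>1 a = m" "\<And>s. s \<in> S \<Longrightarrow> \<sigma>1 s = s"
  proof (rule shear_move_fixing[OF fin S ab(1) m(1)])
    fix s assume "s \<in> S" "s $ Coord_u = a $ Coord_u"
    then have s: "s \<in> ?S" by simp
    have "xpart m - xpart a = w" using m(3) by simp
    then show "\<exists>l. dotp l (xpart m - xpart a) = 0 \<and> dotp l (xpart a - xpart s) \<noteq> 0"
      using dotp_separating[OF l(1) w(1)[OF s] ne(1)[OF s]] by metis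
  qed (use ab m in auto)
  obtain \<sigma>2 where \<sigma>2: "ambient_aut p \<sigma>2" "\<sigma>2 m = b" "\<And>s. s \<in> S \<Longrightarrow> \<sigma>2 s = s"
  proof (rule shear_move_fixing[OF fin S m(1) ab(2)])
    fix s assume "s \<in> S" "s $ Coord_u = m $ Coord_u"
    then have s: "s \<in> ?S" using m by simp
    obtain l1 where l1: "dotp l1 (xpart b - xpart a - w) = 0" "dotp l1 (xpart b - xpart s) \<noteq> 0"
      using dotp_separating[OF l'(1) w(2)[OF s] ne(2)[OF s]] by metis
    \<comment> \<open>As \<open>l1\<close> kills the direction of the second leg, it takes the same
      value at m - s as at b - s.\<close>
    have "xpart b - xpart m = xpart b - xpart a - w"
      "xpart m - xpart s = (xpart b - xpart s) - (xpart b - xpart a - w)"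
      using m(3) by simp_all
    then show "\<exists>l. dotp l (xpart b - xpart m) = 0 \<and> dotp l (xpart m - xpart s) \<noteq> 0"
      using l1 by (metis dotp_diff diff_zero)
  qed (use ab m in auto)
  show ?thesis
    by (rule that[OF ambient_aut_comp[OF \<sigma>2(1) \<sigma>1(1)]]) (use \<sigma>1 \<sigma>2 in auto)
qed

text \<open>Some line through 0 has p nonconstant on it, and the fundamental theorem of algebra
  applies to p - c there.\<close>

lemma poly_eval_surj:
  assumes "p \<notin> range const_poly"
  shows "\<exists>y. poly_eval p y = c"
proof -
  have "p - const_poly (poly_eval p 0) \<noteq> 0" using assms by auto
  then obtain x where x: "poly_eval p x \<noteq> poly_eval p 0"
    using poly_eval_eq_0_imp_eq_0[of "p - const_poly (poly_eval p 0)"] by auto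
  obtain q where q: "\<And>t. poly_eval p (0 + t *s x) = poly q t"
    using polyfun_along_line[of "poly_eval p" 0 x] by auto
  have "poly q 0 \<noteq> poly q 1" using x q[of 0] q[of 1] by simp
  then have "poly (q - [:c:]) 0 \<noteq> poly (q - [:c:]) 1" by simp
  then have "\<not> constant (poly (q - [:c:]))" unfolding constant_def by blast
  then obtain t where "poly (q - [:c:]) t = 0" using fundamental_theorem_of_algebra by blast
  then show ?thesis using q[of t] by (intro exI[of _ "t *s x"]) simp
qed

text \<open>Slices \<open>u = const\<close> and \<open>v = const\<close> intersect: move \<open>a\<close> and \<open>b\<close> in their \<open>u\<close>-slices to points
  with a common \<open>v\<close>-coordinate \<open>c\<close> that does not occur in \<open>S\<close>, and join these in the slice \<open>v = c\<close>.\<close>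

lemma move_u_nonzero_fixing:
  fixes p :: "('k::finite) cpoly"
  assumes card: "CARD('k) \<ge> 2" and p: "p \<notin> range const_poly"
    and fin: "finite S" and S: "\<And>s. s \<in> S \<Longrightarrow> uvp p s = 0"
    and ab: "uvp p a = 0" "uvp p b = 0" "a $ Coord_u \<noteq> 0" "b $ Coord_u \<noteq> 0"
    and notin: "a \<notin> S" "b \<notin> S"
  obtains \<sigma> where "ambient_aut p \<sigma>" "\<sigma> a = b" "\<And>s. s \<in> S \<Longrightarrow> \<sigma> s = s"
proof -
  have "finite (insert 0 ((\<lambda>s. s $ Coord_v) ` S))" using fin by simp
  \<comment> \<open>The value 0 is excluded as well, because the swap turns v = c into a slice u =
    c, in which points can be moved only for c nonzero.\<close>
  then obtain c where c: "c \<notin> insert 0 ((\<lambda>s. s $ Coord_v) ` S)"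
    using ex_new_if_finite[OF infinite_UNIV_char_0] by blast
  obtain y where y: "poly_eval p y = a $ Coord_u * c" using poly_eval_surj[OF p] by blast
  obtain y' where y': "poly_eval p y' = b $ Coord_u * c" using poly_eval_surj[OF p] by blast
  define a' where "a' = mkpt y (a $ Coord_u) c"
  define b' where "b' = mkpt y' (b $ Coord_u) c"
  have a': "uvp p a' = 0" "a' $ Coord_u = a $ Coord_u" "a' $ Coord_v = c"
    and b': "uvp p b' = 0" "b' $ Coord_u = b $ Coord_u" "b' $ Coord_v = c"
    using y y' by (auto simp: a'_def b'_def uvp_def)
  have "s $ Coord_v \<noteq> c" if "s \<in> S" for s using c that by auto
  then have notin': "a' \<notin> S" "b' \<notin> S" using a'(3) b'(3) by auto
  obtain \<sigma>1 where \<sigma>1: "ambient_aut p \<sigma>1" "\<sigma>1 a = a'" "\<And>s. s \<in> S \<Longrightarrow> \<sigma>1 s = s"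
    using move_in_slice_fixing[OF card fin S ab(1) a'(1) _ ab(3) notin(1) notin'(1)] a'(2) by metis
  obtain \<sigma>2 where \<sigma>2: "ambient_aut p \<sigma>2" "\<sigma>2 b' = b" "\<And>s. s \<in> S \<Longrightarrow> \<sigma>2 s = s"
    using move_in_slice_fixing[OF card fin S b'(1) ab(2) _ _ notin'(2) notin(2)] b'(2) ab(4) by metis
  obtain \<sigma>3 where \<sigma>3: "ambient_aut p \<sigma>3" "\<sigma>3 (swap a') = swap b'" "\<And>s. s \<in> swap ` S \<Longrightarrow> \<sigma>3 s = s"
  proof (rule move_in_slice_fixing[OF card, of "swap ` S" p "swap a'" "swap b'"])
    show "swap a' \<notin> swap ` S" "swap b' \<notin> swap ` S"
      using notin' by (metis imageE swap_swap)+
  qed (use fin S a' b' c in auto)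
  let ?\<sigma> = "\<lambda>z. \<sigma>2 (swap (\<sigma>3 (swap (\<sigma>1 z))))"
  show ?thesis
  proof (rule that)
    show "ambient_aut p ?\<sigma>"
      by (rule ambient_aut_comp[OF \<sigma>2(1) ambient_aut_comp[OF ambient_aut_swap
            ambient_aut_comp[OF \<sigma>3(1) ambient_aut_comp[OF ambient_aut_swap \<sigma>1(1)]]]])
    show "?\<sigma> a = b" using \<sigma>1 \<sigma>2 \<sigma>3 by simp
    show "?\<sigma> s = s" if "s \<in> S" for s using that \<sigma>1 \<sigma>2 \<sigma>3 by simp
  qed
qed

section \<open>Transitivity on the noncritical points\<close>

definition noncritical :: "('k::finite) cpoly \<Rightarrow> (complex ^ 'k coord) set"
  where "noncritical p = {z. uvp p z = 0 \<and> (\<exists>w. dirderiv (uvp p) z w \<noteq> 0)}"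

lemma ambient_aut_noncritical_mem:
  "ambient_aut p \<sigma> \<Longrightarrow> z \<in> noncritical p \<Longrightarrow> \<sigma> z \<in> noncritical p"
  unfolding noncritical_def using ambient_aut_noncritical[of p \<sigma> z] ambient_aut_uvp[of p \<sigma> z] by auto

text \<open>Conjugation by a map that takes \<open>a\<close> and \<open>b\<close> off u = 0. The
  points of \<open>S\<close> may lie on u = 0, since a shear with h = 0 there fixes them.\<close>

lemma move_noncritical_fixing:
  fixes p :: "('k::finite) cpoly"
  assumes card: "CARD('k) \<ge> 2" and p: "p \<notin> range const_poly"
    and fin: "finite S" and S: "S \<subseteq> noncritical p"
    and ab: "a \<in> noncritical p" "b \<in> noncritical p"
    and notin: "a \<notin> S" "b \<notin> S"
  obtains \<sigma> where "ambient_aut p \<sigma>" "\<sigma> a = b" "\<And>s. s \<in> S \<Longrightarrow> \<sigma> s = s"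
proof -
  obtain y where "poly_eval p y = 1" using poly_eval_surj[OF p] by blast
  then have y: "poly_eval p y \<noteq> 0" by simp
  obtain \<tau> where \<tau>: "ambient_aut p \<tau>" "\<And>z. z \<in> {a, b} \<Longrightarrow> \<tau> z $ Coord_u \<noteq> 0"
    using move_off_u_0[of "{a, b}" p y] ab y by (auto simp: noncritical_def)
  obtain \<tau>' where \<tau>': "ambient_aut p \<tau>'" "\<And>z. \<tau> (\<tau>' z) = z" "\<And>z. \<tau>' (\<tau> z) = z"
    using ambient_aut_inverse[OF \<tau>(1)] by blast
  obtain \<rho> where \<rho>: "ambient_aut p \<rho>" "\<rho> (\<tau> a) = \<tau> b" "\<And>s. s \<in> \<tau> ` S \<Longrightarrow> \<rho> s = s"
  proof (rule move_u_nonzero_fixing[OF card p, of "\<tau> ` S" "\<tau> a" "\<tau> b"])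
    show "\<tau> a \<notin> \<tau> ` S" "\<tau> b \<notin> \<tau> ` S"
      using notin by (auto simp: ambient_aut_inj[OF \<tau>(1)])
  qed (use fin S ab \<tau> in \<open>auto simp: noncritical_def ambient_aut_uvp\<close>)
  show ?thesis
  proof (rule that)
    show "ambient_aut p (\<lambda>z. \<tau>' (\<rho> (\<tau> z)))"
      by (rule ambient_aut_comp[OF \<tau>'(1) ambient_aut_comp[OF \<rho>(1) \<tau>(1)]])
  qed (use \<rho> \<tau>' in auto)
qed

text \<open>Points are put in place one at a time, each moved while the targets already reached stay
  fixed; this is why the moves above fix a finite set.\<close>

lemma ambient_multiply_transitive:
  fixes p :: "('k::finite) cpoly" and m :: nat
  assumes card: "CARD('k) \<ge> 2" and p: "p \<notin> range const_poly"
    and "P ` {..<m} \<subseteq> noncritical p" "inj_on P {..<m}"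
    and "Q ` {..<m} \<subseteq> noncritical p" "inj_on Q {..<m}"
  shows "\<exists>\<sigma>. ambient_aut p \<sigma> \<and> (\<forall>i<m. \<sigma> (P i) = Q i)"
  using assms(3-6)
proof (induction m)
  case 0
  show ?case using ambient_aut_id by blast
next
  case (Suc m)
  then obtain \<sigma> where \<sigma>: "ambient_aut p \<sigma>" "\<And>i. i < m \<Longrightarrow> \<sigma> (P i) = Q i"
    by (auto simp: lessThan_Suc)
  obtain \<rho> where \<rho>: "ambient_aut p \<rho>" "\<rho> (\<sigma> (P m)) = Q m" "\<And>s. s \<in> Q ` {..<m} \<Longrightarrow> \<rho> s = s"
  proof (rule move_noncritical_fixing[OF card p, of "Q ` {..<m}" "\<sigma> (P m)" "Q m"])
    show "\<sigma> (P m) \<notin> Q ` {..<m}"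
    proof
      assume "\<sigma> (P m) \<in> Q ` {..<m}"
      then obtain i where "i < m" "\<sigma> (P m) = \<sigma> (P i)" using \<sigma>(2) by auto
      then have "i < m" "P m = P i" by (simp_all add: ambient_aut_inj[OF \<sigma>(1)])
      with inj_onD[OF Suc.prems(2) \<open>P m = P i\<close>] show False by simp
    qed
    show "Q m \<notin> Q ` {..<m}" using Suc.prems(4) by (auto simp: lessThan_Suc)
    show "\<sigma> (P m) \<in> noncritical p"
      using Suc.prems(1) by (intro ambient_aut_noncritical_mem[OF \<sigma>(1)]) auto
  qed (use Suc.prems in auto)
  have "\<rho> (\<sigma> (P i)) = Q i" if "i < Suc m" for i
    using that \<sigma>(2)[of i] \<rho>(2) \<rho>(3)[of "Q i"] by (cases "i = m") auto
  then show ?case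
    using ambient_aut_comp[OF \<rho>(1) \<sigma>(1)] by (intro exI[of _ "\<lambda>z. \<rho> (\<sigma> z)"]) auto
qed

theorem mainTheorem1:
  fixes p :: "('k::finite) cpoly" and X :: "(complex ^ 'k coord) set"
  assumes "CARD('k) \<ge> 2"
    and "p \<notin> range const_poly"
    and "X = uv_hypersurface p"
  shows "\<forall>m::nat. acts_m_transitively m (Aut X) (X - sing X) (\<lambda>g. restrict g (X - sing X))"
proof
  fix m :: nat
  have X: "X = {z. uvp p z = 0}" using assms(3) by (simp add: uv_hypersurface_eq)
  \<comment> \<open>Tuples of regular points are thus tuples of noncritical points and are joined by
    ambient maps, whose restrictions to \<open>X\<close> are automorphisms.\<close>
  have reg: "X - sing X \<subseteq> noncritical p"
    using critical_point_singular by (auto simp: X noncritical_def)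
  have "group_action (Aut X) (X - sing X) (\<lambda>g. restrict g (X - sing X))"
    unfolding X by (intro group_action_Aut zariski_closed_zero_set polyfun_uvp)
  moreover have "\<exists>g\<in>carrier (Aut X). \<forall>i<m. restrict g (X - sing X) (P i) = Q i"
    if PQ: "P ` {..<m} \<subseteq> X - sing X" "inj_on P {..<m}" "Q ` {..<m} \<subseteq> X - sing X" "inj_on Q {..<m}" for P Q
  proof -
    obtain \<sigma> where \<sigma>: "ambient_aut p \<sigma>" "\<And>i. i < m \<Longrightarrow> \<sigma> (P i) = Q i"
      using ambient_multiply_transitive[OF assms(1,2) subset_trans[OF PQ(1) reg] PQ(2)
          subset_trans[OF PQ(3) reg] PQ(4)] by auto
    have "P i \<in> X - sing X" if "i < m" for i
      using PQ(1) that by blast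
    then show ?thesis
      using \<sigma> ambient_aut_restrict[OF \<sigma>(1)] unfolding X[symmetric]
      by (intro bexI[of _ "restrict \<sigma> X"]) auto
  qed
  ultimately show "acts_m_transitively m (Aut X) (X - sing X) (\<lambda>g. restrict g (X - sing X))"
    unfolding acts_m_transitively_def by blast
qed

end
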